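(* Let $\mathrm{Zh}=\mathbb C[z_{11},z_{12},z_{21},z_{22},N(Z)^{-1}]$ with the Lie algebra action $\rho_1$ of $\mathfrak{gl}(2,\mathbb H_{\mathbb C})\simeq\mathfrak{gl}(4,\mathbb C)$ described below. Define $\mathrm{Zh}^+=\operatorname{span}_{\mathbb C}\{t^l_{nm}(Z)N(Z)^k: k\ge0\}$, $\mathrm{Zh}^-=\operatorname{span}_{\mathbb C}\{t^l_{nm}(Z)N(Z)^k: k\le-(2l+2)\}$, $\mathrm{Zh}^0=\operatorname{span}_{\mathbb C}\{t^l_{nm}(Z)N(Z)^k: -(2l+1)\le k\le -1\}$ (with $k\in\mathbb Z$, $l\in\{0,\frac12,1,\dots\}$, $m,n\in\{-l,\dots,l\}$). Then $\mathrm{Zh}=\mathrm{Zh}^-\oplus\mathrm{Zh}^0\oplus\mathrm{Zh}^+$, each of the three summands is invariant under $\rho_1(\mathfrak{gl}(2,\mathbb H_{\mathbb C}))$, and each is an irreducible representation of $\mathfrak{gl}(2,\mathbb H_{\mathbb C})$.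
   Context: $\mathbb H_{\mathbb C}$ is identified with complex $2\times2$ matrices $Z=(z_{ij})$, $N(Z)=\det Z$, and $t^l_{nm}(Z)=\frac1{2\pi i}\oint (sz_{11}+z_{21})^{l-m}(sz_{12}+z_{22})^{l+m}s^{-l+n}\,\frac{ds}{s}$ (loop once counterclockwise around $0$), for $l\in\{0,\frac12,1,\dots\}$, $m,n\in\mathbb Z+l$, $-l\le m,n\le l$. The Lie algebra $\mathfrak{gl}(2,\mathbb H_{\mathbb C})$ consists of block matrices $\begin{pmatrix}A&B\\C&D\end{pmatrix}$ with $A,B,C,D$ complex $2\times2$ matrices. Writing $\partial f$ for the matrix $\begin{pmatrix}\partial f/\partial z_{11}&\partial f/\partial z_{21}\\ \partial f/\partial z_{12}&\partial f/\partial z_{22}\end{pmatrix}$, the action $\rho_1$ on $f\in\mathrm{Zh}$ is $$\rho_1\begin{pmatrix}A&B\\C&D\end{pmatrix}f=\operatorname{Tr}\big(A(-Z\,\partial f-f)\big)+\operatorname{Tr}\big(B(-\partial f)\big)+\operatorname{Tr}\big(C(Z(\partial f)Z+2Zf)\big)+\operatorname{Tr}\big(D((\partial f)Z+f)\big).$$ *)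

theory Defs
  imports "HOL-Analysis.Analysis"
begin

text \<open>Quaternionic 2x2 complex matrices: Z :: complex^2^2, entry z_ij is Z$i$j
  (i = row index, j = column index, with i,j in {1,2}). N(Z) = det Z.
  Elements of Zh are represented as complex-valued functions on all 2x2 matrices
  which vanish outside GL(2,C) = {Z. det Z \<noteq> 0}; equality of such functions is
  equality as functions on the domain {det Z \<noteq> 0}.\<close>

definition onGL :: "(complex^2^2 \<Rightarrow> complex) \<Rightarrow> complex^2^2 \<Rightarrow> complex" where
  "onGL g = (\<lambda>Z. if det Z = 0 then 0 else g Z)"

definition cspan :: "('a \<Rightarrow> complex) set \<Rightarrow> ('a \<Rightarrow> complex) set" where
  "cspan S = {f. \<exists>T c. finite T \<and> T \<subseteq> S \<and> f = (\<lambda>x. \<Sum>g\<in>T. c g * g x)}"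

definition csubspace :: "('a \<Rightarrow> complex) set \<Rightarrow> bool" where
  "csubspace W \<longleftrightarrow> (\<lambda>x. 0) \<in> W \<and> (\<forall>f\<in>W. \<forall>g\<in>W. (\<lambda>x. f x + g x) \<in> W)
     \<and> (\<forall>c. \<forall>f\<in>W. (\<lambda>x. c * f x) \<in> W)"

definition Zh :: "(complex^2^2 \<Rightarrow> complex) set" where
  "Zh = cspan {onGL (\<lambda>Z. (Z$1$1)^a * (Z$1$2)^b * (Z$2$1)^c * (Z$2$2)^d * (inverse (det Z))^k)
              | a b c d k. True}"

text \<open>Matrix coefficient t^l_{nm}(Z), with l = j/2, m = p/2, n = q/2 (j natural, p q integers
  of the same parity as j, |p|,|q| \<le> j). The contour integral over the unit circle
  (counterclockwise) is written out via the parametrisation s = e^{i\<theta>}, 0 \<le> \<theta> \<le> 2\<pi>: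
  (1/2\<pi>i) \<ointegral> g(s) ds/s = (1/2\<pi>) \<integral>_0^{2\<pi>} g(e^{i\<theta>}) d\<theta>.\<close>
definition tlnm :: "nat \<Rightarrow> int \<Rightarrow> int \<Rightarrow> complex^2^2 \<Rightarrow> complex" where
  "tlnm j p q Z = complex_of_real (1 / (2 * pi)) *
     integral {0..2*pi} (\<lambda>\<theta>::real.
        (cis \<theta> * Z$1$1 + Z$2$1) ^ nat ((int j - p) div 2)
      * (cis \<theta> * Z$1$2 + Z$2$2) ^ nat ((int j + p) div 2)
      * (cis \<theta>) powi ((q - int j) div 2))"

definition valid_idx :: "nat \<Rightarrow> int \<Rightarrow> int \<Rightarrow> bool" where
  "valid_idx j p q \<longleftrightarrow> \<bar>p\<bar> \<le> int j \<and> \<bar>q\<bar> \<le> int j \<and> even (int j - p) \<and> even (int j - q)"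

definition tN :: "nat \<Rightarrow> int \<Rightarrow> int \<Rightarrow> int \<Rightarrow> complex^2^2 \<Rightarrow> complex" where
  "tN j p q k = onGL (\<lambda>Z. tlnm j p q Z * (det Z) powi k)"

definition Zh_plus :: "(complex^2^2 \<Rightarrow> complex) set" where
  "Zh_plus = cspan {tN j p q k | j p q k. valid_idx j p q \<and> k \<ge> 0}"

definition Zh_minus :: "(complex^2^2 \<Rightarrow> complex) set" where
  "Zh_minus = cspan {tN j p q k | j p q k. valid_idx j p q \<and> k \<le> - (int j + 2)}"

definition Zh_zero :: "(complex^2^2 \<Rightarrow> complex) set" where
  "Zh_zero = cspan {tN j p q k | j p q k. valid_idx j p q \<and> - (int j + 1) \<le> k \<and> k \<le> -1}"

definition pd :: "2 \<Rightarrow> 2 \<Rightarrow> (complex^2^2 \<Rightarrow> complex) \<Rightarrow> complex^2^2 \<Rightarrow> complex" where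
  "pd i j f Z = deriv (\<lambda>w. f (\<chi> r s. if r = i \<and> s = j then w else Z$r$s)) (Z$i$j)"

definition dmat :: "(complex^2^2 \<Rightarrow> complex) \<Rightarrow> complex^2^2 \<Rightarrow> complex^2^2" where
  "dmat f Z = (\<chi> i j. pd j i f Z)"

definition mtr :: "complex^2^2 \<Rightarrow> complex" where
  "mtr M = (\<Sum>i\<in>UNIV. M$i$i)"

text \<open>The action \<rho>_1 of the block matrix (A B; C D) in gl(2,H_C).\<close>
definition rho1 :: "complex^2^2 \<Rightarrow> complex^2^2 \<Rightarrow> complex^2^2 \<Rightarrow> complex^2^2
     \<Rightarrow> (complex^2^2 \<Rightarrow> complex) \<Rightarrow> complex^2^2 \<Rightarrow> complex" where
  "rho1 A B C D f = onGL (\<lambda>Z.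
      mtr (A ** (- (Z ** dmat f Z) - mat (f Z)))
    + mtr (B ** (- dmat f Z))
    + mtr (C ** (Z ** dmat f Z ** Z + mat (2 * f Z) ** Z))
    + mtr (D ** (dmat f Z ** Z + mat (f Z))))"

definition rho1_invariant :: "(complex^2^2 \<Rightarrow> complex) set \<Rightarrow> bool" where
  "rho1_invariant W \<longleftrightarrow> (\<forall>A B C D. \<forall>f\<in>W. rho1 A B C D f \<in> W)"

definition rho1_irreducible :: "(complex^2^2 \<Rightarrow> complex) set \<Rightarrow> bool" where
  "rho1_irreducible V \<longleftrightarrow> V \<noteq> {\<lambda>Z. 0} \<and>
     (\<forall>W. csubspace W \<and> W \<subseteq> V \<and> rho1_invariant W \<longrightarrow> W = {\<lambda>Z. 0} \<or> W = V)"

end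

(* Write N = det Z. Besides the t^l_{nm} it is convenient to use the divided-power polynomials
   S(a,b,c), where a = l - m, b = l + m and c = l - n, so that t^l_{nm} = a! b! S(a,b,c). Partial
   derivatives only shift the indices of S, and multiplication by an entry z_ij sends S(a,b,c) N^k to a
   combination of the levels (j+1, k) and (j-1, k+1), where j = 2l = a + b. Hence on level (j, k) the
   translations B act by a component to (j-1, k) with factor j+1+k and a component to (j+1, k-1)
   with factor k; C acts by components to (j+1, k) with factor j+k+2 and to (j-1, k+1) with factor
   k+1; A and D preserve the level. The zeros of these four factors cut out the three summands.

   The weights of the diagonal matrices together with a Casimir-type operator separate the basis
   vectors S(a,b,c) N^k, so an invariant subspace contains every basis vector that occurs in one of
   its elements. This gives linear independence (apply it to the zero subspace), and reduces
   irreducibility to the fact that within each region any level can be reached from any other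
   along steps with nonzero factor. *)

theory Submission
  imports Defs
begin

section \<open>The polynomials S(a,b,c)\<close>

text \<open>Write Z with rows (x, y) and (z, w). Extending divided powers by zero to negative
  exponents makes the index shifts valid for all integers: whatever leaves the range of a level
  vanishes by itself, so the shift identities need no boundary cases. The expansion of an entry
  times S(a,b,c) carries the denominator j + 1, and these identities are therefore kept multiplied
  by a + b + 1. The factors arise when contributions are collected. Differentiating S N^k gives S'
  N^k and k times an entry times S N^(k-1); expanding that product returns k/(j+1) more of S' N^k,
  whence (j+1+k)/(j+1). Diagonal matrices alone cannot separate the basis: the two row weights and
  the two column weights have the same sum, so four indices face three independent weights. For
  instance S(1,1,1) = xw + yz and N = xw - yz have equal weights; only the Casimir-type operator
  tells them apart.\<close>

definition divpow :: "complex \<Rightarrow> int \<Rightarrow> complex" where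
  "divpow x n = (if n < 0 then 0 else x ^ nat n / fact (nat n))"

lemma divpow_neg [simp]: "n < 0 \<Longrightarrow> divpow x n = 0"
  by (simp add: divpow_def)

lemma divpow_0 [simp]: "divpow x 0 = 1"
  by (simp add: divpow_def)

lemma mult_divpow: "x * divpow x n = of_int (n + 1) * divpow x (n + 1)"
proof (cases "n < 0")
  case True
  \<comment> \<open>At n = -1 the divided power on the right is 1, and the factor n + 1 = 0 saves
    the identity.\<close>
  then show ?thesis by (cases "n = -1") auto
next
  case False
  then obtain m where "n = int m" by (metis nat_0_le not_less)
  then show ?thesis
    by (simp add: divpow_def nat_add_distrib divide_simps del: of_nat_Suc) (simp add: algebra_simps)
qed

lemma DERIV_divpow: "((\<lambda>x. divpow x n) has_field_derivative divpow x (n - 1)) (at x)"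
proof (cases "n \<le> 0")
  case True
  then have "(\<lambda>x. divpow x n) = (\<lambda>x. if n = 0 then 1 else 0)" by auto
  with True show ?thesis by simp
next
  case False
  define m where "m = nat (n - 1)"
  have m: "n = int (Suc m)" using False by (simp add: m_def)
  have "((\<lambda>x. x ^ Suc m / fact (Suc m)) has_field_derivative
      (of_nat (Suc m) * x ^ m) / fact (Suc m)) (at x)"
    by (rule DERIV_cong[OF DERIV_cdivide[OF DERIV_power_Suc[OF DERIV_ident]]]) simp
  moreover have "(of_nat (Suc m) * x ^ m) / fact (Suc m) = x ^ m / (fact m :: complex)"
    by (simp add: fact_Suc del: of_nat_Suc)
  moreover have "(\<lambda>x. divpow x n) = (\<lambda>x. x ^ Suc m / fact (Suc m))"
    by (simp add: m divpow_def nat_add_distrib del: fact_Suc)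
  ultimately show ?thesis by (simp add: m divpow_def)
qed

text \<open>This is the coefficient of s^c in (s x + z)^a (s y + w)^b / (a! b!). The exponents of x,
  y, z, w form a 2x2 matrix with column sums a, b and row sums c, a + b - c, which explains the
  symmetries under swaps and transposition.\<close>

definition Spol :: "int \<Rightarrow> int \<Rightarrow> int \<Rightarrow> complex \<Rightarrow> complex \<Rightarrow> complex \<Rightarrow> complex \<Rightarrow> complex" where
  "Spol a b c x y z w =
     (\<Sum>i\<in>{0..a}. divpow x i * divpow y (c - i) * divpow z (a - i) * divpow w (b - c + i))"

text \<open>Terms outside 0..a vanish, so the window of summation can be enlarged until several sums
  share it.\<close>

lemma Spol_eq_sum:
  assumes "l \<le> 0" "a \<le> h"
  shows "Spol a b c x y z w =
     (\<Sum>i\<in>{l..h}. divpow x i * divpow y (c - i) * divpow z (a - i) * divpow w (b - c + i))"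
  unfolding Spol_def using assms
  by (intro sum.mono_neutral_left) auto

lemma sum_int_shift: "(\<Sum>i\<in>{l..h}. f (i + n)) = (\<Sum>i\<in>{l + n..h + n::int}. f i)"
  by (rule sum.reindex_bij_witness[where i = "\<lambda>i. i - n" and j = "\<lambda>i. i + n"]) auto

lemma Spol_eq_sum_pred:
  assumes "l \<le> 1" "a + 1 \<le> h"
  shows "Spol a b c x y z w = (\<Sum>i\<in>{l..h}.
     divpow x (i - 1) * divpow y (c + 1 - i) * divpow z (a + 1 - i) * divpow w (b - c - 1 + i))"
proof -
  have "Spol a b c x y z w = (\<Sum>i\<in>{l - 1..h - 1}.
     divpow x i * divpow y (c - i) * divpow z (a - i) * divpow w (b - c + i))"
    using assms by (intro Spol_eq_sum) auto
  also have "\<dots> = (\<Sum>i\<in>{l + (-1)..h + (-1)}.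
     divpow x i * divpow y (c - i) * divpow z (a - i) * divpow w (b - c + i))" by simp
  also have "\<dots> = (\<Sum>i\<in>{l..h}.
     divpow x (i - 1) * divpow y (c + 1 - i) * divpow z (a + 1 - i) * divpow w (b - c - 1 + i))"
    by (subst sum_int_shift[symmetric], rule sum.cong) (simp_all add: algebra_simps)
  finally show ?thesis .
qed

text \<open>The numbers a, b, c and a + b - c are row and column sums of the exponents; a negative
  sum forces a negative exponent in every term.\<close>

lemma Spol_invalid:
  assumes "a < 0 \<or> b < 0 \<or> c < 0 \<or> a + b < c"
  shows "Spol a b c x y z w = 0"
proof -
  have *: "divpow x i * divpow y (c - i) * divpow z (a - i) * divpow w (b - c + i) = 0" for i
    using assms by (cases "i < 0 \<or> c - i < 0 \<or> a - i < 0 \<or> b - c + i < 0") auto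
  show ?thesis unfolding Spol_def by (simp only: *) simp
qed

lemma DERIV_Spol_x: "((\<lambda>x. Spol a b c x y z w) has_field_derivative Spol (a - 1) b (c - 1) x y z w) (at x)"
proof -
  have "Spol (a - 1) b (c - 1) x y z w = (\<Sum>i\<in>{0..a}. divpow x (i - 1) * divpow y (c - i)
      * divpow z (a - i) * divpow w (b - c + i))"
    by (subst Spol_eq_sum_pred[of 0 _ a]) auto
  then show ?thesis unfolding Spol_def
    by (auto intro!: DERIV_sum DERIV_cmult_right DERIV_divpow)
qed

lemma DERIV_Spol_y: "((\<lambda>y. Spol a b c x y z w) has_field_derivative Spol a (b - 1) (c - 1) x y z w) (at y)"
proof -
  have "Spol a (b - 1) (c - 1) x y z w = (\<Sum>i\<in>{0..a}. divpow x i * divpow y (c - i - 1)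
      * divpow z (a - i) * divpow w (b - c + i))"
    unfolding Spol_def by (rule sum.cong) (simp_all add: algebra_simps)
  then show ?thesis unfolding Spol_def
    by (auto intro!: DERIV_sum DERIV_cmult_right DERIV_cmult DERIV_divpow)
qed

lemma DERIV_Spol_z: "((\<lambda>z. Spol a b c x y z w) has_field_derivative Spol (a - 1) b c x y z w) (at z)"
proof -
  have "Spol (a - 1) b c x y z w = (\<Sum>i\<in>{0..a}. divpow x i * divpow y (c - i)
      * divpow z (a - 1 - i) * divpow w (b - c + i))"
    by (rule Spol_eq_sum) auto
  also have "\<dots> = (\<Sum>i\<in>{0..a}. divpow x i * divpow y (c - i)
      * divpow z (a - i - 1) * divpow w (b - c + i))"
    by (rule sum.cong) (simp_all add: algebra_simps)
  finally show ?thesis unfolding Spol_def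
    by (auto intro!: DERIV_sum DERIV_cmult_right DERIV_cmult DERIV_divpow)
qed

lemma DERIV_Spol_w: "((\<lambda>w. Spol a b c x y z w) has_field_derivative Spol a (b - 1) c x y z w) (at w)"
proof -
  have "Spol a (b - 1) c x y z w = (\<Sum>i\<in>{0..a}. divpow x i * divpow y (c - i)
      * divpow z (a - i) * divpow w (b - c + i - 1))"
    unfolding Spol_def by (rule sum.cong) (simp_all add: algebra_simps)
  then show ?thesis unfolding Spol_def
    by (auto intro!: DERIV_sum DERIV_cmult DERIV_divpow)
qed

lemma product_rearrange:
  fixes x :: "'a::comm_ring_1"
  assumes "x * p * (w * q) = of_int m * p' * (of_int n * q')"
  shows "x * w * (p * r * s * q) = of_int (m * n) * (p' * r * s * q')"
proof -
  have "x * w * (p * r * s * q) = x * p * (w * q) * r * s" by (simp only: mult_ac)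
  also have "\<dots> = of_int (m * n) * (p' * r * s * q')" unfolding assms by (simp only: of_int_mult mult_ac)
  finally show ?thesis .
qed

lemma product_rearrange_inner:
  fixes y :: "'a::comm_ring_1"
  assumes "y * p * (z * q) = of_int m * p' * (of_int n * q')"
  shows "y * z * (r * p * q * s) = of_int (m * n) * (r * p' * q' * s)"
proof -
  have "y * z * (r * p * q * s) = y * p * (z * q) * r * s" by (simp only: mult_ac)
  also have "\<dots> = of_int (m * n) * (r * p' * q' * s)" unfolding assms by (simp only: of_int_mult mult_ac)
  finally show ?thesis .
qed

text \<open>After an index shift both sides are sums over the same monomials, whose coefficients are compared.
  Multiplication by the other three entries follows by swapping rows and columns.\<close>

lemma mult_x_Spol:
  "of_int (a + b + 1) * x * Spol a b c x y z w =
     of_int ((c + 1) * (a + 1)) * Spol (a + 1) b (c + 1) x y z w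
     + (x * w - y * z) * Spol a (b - 1) c x y z w"
proof -
  define M where "M i = divpow x i * divpow y (c + 1 - i) * divpow z (a + 1 - i)
      * divpow w (b - c - 1 + i)" for i
  define I where "I = {- 1..a + 2}"
  have 1: "x * Spol a b c x y z w = (\<Sum>i\<in>I. of_int i * M i)"
    unfolding I_def M_def
    by (subst Spol_eq_sum_pred[of "-1" _ "a + 2"])
      (simp_all add: sum_distrib_left mult.assoc[symmetric] mult_divpow)
  have 2: "Spol (a + 1) b (c + 1) x y z w = (\<Sum>i\<in>I. M i)"
    unfolding I_def M_def
    by (subst Spol_eq_sum[of "-1" _ "a + 2"]) (simp_all add: algebra_simps)
  have 3: "x * w * Spol a (b - 1) c x y z w = (\<Sum>i\<in>I. of_int (i * (b - c - 1 + i)) * M i)"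
    unfolding I_def M_def
  proof (subst Spol_eq_sum_pred[of "-1" _ "a + 2"], simp, simp, subst sum_distrib_left, rule sum.cong, simp)
    fix i
    have "x * divpow x (i - 1) = of_int i * divpow x i"
      and "w * divpow w (b - 1 - c - 1 + i) = of_int (b - c - 1 + i) * divpow w (b - c - 1 + i)"
      using mult_divpow[of x "i - 1"] mult_divpow[of w "b - 1 - c - 1 + i"]
      by (simp_all add: algebra_simps)
    from arg_cong2[where f = "(*)", OF this] show "x * w * (divpow x (i - 1) * divpow y (c + 1 - i) * divpow z (a + 1 - i)
        * divpow w (b - 1 - c - 1 + i)) =
      of_int (i * (b - c - 1 + i)) * (divpow x i * divpow y (c + 1 - i) * divpow z (a + 1 - i)
        * divpow w (b - c - 1 + i))"
      by (rule product_rearrange)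
  qed
  have 4: "y * z * Spol a (b - 1) c x y z w =
      (\<Sum>i\<in>I. of_int ((c + 1 - i) * (a + 1 - i)) * M i)"
    unfolding I_def M_def
  proof (subst Spol_eq_sum[of "-1" _ "a + 2"], simp, simp, subst sum_distrib_left, rule sum.cong, simp)
    fix i
    have eq: "b - 1 - c + i = b - c - 1 + i" by simp
    have "y * divpow y (c - i) = of_int (c + 1 - i) * divpow y (c + 1 - i)"
      and "z * divpow z (a - i) = of_int (a + 1 - i) * divpow z (a + 1 - i)"
      using mult_divpow[of y "c - i"] mult_divpow[of z "a - i"]
      by (simp_all add: algebra_simps)
    from arg_cong2[where f = "(*)", OF this] show "y * z * (divpow x i * divpow y (c - i) * divpow z (a - i)
        * divpow w (b - 1 - c + i)) =
      of_int ((c + 1 - i) * (a + 1 - i)) * (divpow x i * divpow y (c + 1 - i) * divpow z (a + 1 - i)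
        * divpow w (b - c - 1 + i))"
      unfolding eq by (rule product_rearrange_inner)
  qed
  \<comment> \<open>The coefficients of \<open>M i\<close> agree because (a+b+1) i = (c+1)(a+1) + i
    (b-c-1+i) - (c+1-i)(a+1-i).\<close>
  have "of_int (a + b + 1) * (x * Spol a b c x y z w) =
     of_int ((c + 1) * (a + 1)) * Spol (a + 1) b (c + 1) x y z w
     + x * w * Spol a (b - 1) c x y z w - y * z * Spol a (b - 1) c x y z w"
    unfolding 1 2 3 4 sum_distrib_left sum.distrib[symmetric] sum_subtractf[symmetric]
    by (rule sum.cong) (simp_all add: algebra_simps)
  then show ?thesis by (simp add: algebra_simps)
qed


lemma Spol_swap_columns: "Spol a b c x y z w = Spol b a c y x w z"
proof -
  \<comment> \<open>The window contains 0..b and its reflection under i -> c - i contains 0..a, so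
    both sums may be taken over it.\<close>
  define l h where "l = min 0 (c - a)" and "h = max b c"
  have "Spol b a c y x w z = (\<Sum>i\<in>{l..h}. divpow y i * divpow x (c - i) * divpow w (b - i)
      * divpow z (a - c + i))"
    by (rule Spol_eq_sum) (auto simp: l_def h_def)
  also have "\<dots> = (\<Sum>i\<in>{c - h..c - l}. divpow x i * divpow y (c - i) * divpow z (a - i)
      * divpow w (b - c + i))"
    by (rule sum.reindex_bij_witness[where i = "\<lambda>i. c - i" and j = "\<lambda>i. c - i"])
      (auto simp: algebra_simps)
  also have "\<dots> = Spol a b c x y z w"
    by (rule Spol_eq_sum[symmetric]) (auto simp: l_def h_def)
  finally show ?thesis by simp
qed

lemma Spol_swap_rows: "Spol a b c x y z w = Spol a b (a + b - c) z w x y"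
  unfolding Spol_def
  by (rule sum.reindex_bij_witness[where i = "\<lambda>i. a - i" and j = "\<lambda>i. a - i"])
    (auto simp: algebra_simps)

lemma mult_y_Spol:
  "of_int (a + b + 1) * y * Spol a b c x y z w =
     of_int ((c + 1) * (b + 1)) * Spol a (b + 1) (c + 1) x y z w
     - (x * w - y * z) * Spol (a - 1) b c x y z w"
  unfolding Spol_swap_columns[of _ _ _ x y z w]
  using mult_x_Spol[of b a y c x w z] by (simp add: algebra_simps)

lemma mult_z_Spol:
  "of_int (a + b + 1) * z * Spol a b c x y z w =
     of_int ((a + b - c + 1) * (a + 1)) * Spol (a + 1) b c x y z w
     - (x * w - y * z) * Spol a (b - 1) (c - 1) x y z w"
  unfolding Spol_swap_rows[of _ _ _ x y z w]
  using mult_x_Spol[of a b z "a + b - c" w x y] by (simp add: algebra_simps)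

lemma mult_w_Spol:
  "of_int (a + b + 1) * w * Spol a b c x y z w =
     of_int ((a + b - c + 1) * (b + 1)) * Spol a (b + 1) c x y z w
     + (x * w - y * z) * Spol (a - 1) b (c - 1) x y z w"
  unfolding Spol_swap_rows[of _ _ _ x y z w]
  using mult_y_Spol[of a b w "a + b - c" z x y] by (simp add: algebra_simps)

lemma Spol_one:
  assumes "0 \<le> b"
  shows "Spol 0 b 0 1 0 0 1 = 1 / fact (nat b)"
  using assms by (simp add: Spol_def divpow_def)

section \<open>The functions S(a,b,c) N^k: derivatives, products and Euler identities\<close>

definition eb :: "int \<Rightarrow> int \<Rightarrow> int \<Rightarrow> int \<Rightarrow> complex^2^2 \<Rightarrow> complex" where
  "eb a b c k = onGL (\<lambda>Z. Spol a b c (Z$1$1) (Z$1$2) (Z$2$1) (Z$2$2) * det Z powi k)"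

definition upd :: "complex^2^2 \<Rightarrow> 2 \<Rightarrow> 2 \<Rightarrow> complex \<Rightarrow> complex^2^2" where
  "upd Z i j w = (\<chi> r s. if r = i \<and> s = j then w else Z$r$s)"

lemma pd_eq_deriv_upd: "pd i j f Z = deriv (\<lambda>w. f (upd Z i j w)) (Z$i$j)"
  by (simp add: pd_def upd_def)

lemma upd_same [simp]: "upd Z i j (Z$i$j) = Z"
  by (simp add: upd_def vec_eq_iff)

lemma upd_nth [simp]: "upd Z i j w $ r $ s = (if r = i \<and> s = j then w else Z$r$s)"
  by (simp add: upd_def)

text \<open>Invertibility is an open condition along the line that varies one entry, so the cutoff
  in \<open>onGL\<close> is invisible near an invertible Z.\<close>

lemma has_derivative_onGL:
  assumes "det Z \<noteq> 0"
    and "((\<lambda>w. g (upd Z i j w)) has_field_derivative D) (at (Z$i$j))"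
  shows "((\<lambda>w. onGL g (upd Z i j w)) has_field_derivative D) (at (Z$i$j))"
proof (rule has_field_derivative_transform_within_open[OF assms(2)])
  have "continuous_on UNIV (\<lambda>w. upd Z i j w $ r $ s)" for r s
    by (cases "r = i \<and> s = j") auto
  then have "continuous_on UNIV (\<lambda>w. det (upd Z i j w))"
    unfolding det_2 by (intro continuous_on_diff continuous_on_mult)
  then show "open {w. det (upd Z i j w) \<noteq> 0}"
    by (intro open_Collect_neq) auto
qed (use assms(1) in \<open>auto simp: onGL_def\<close>)

lemma DERIV_eb_gen:
  assumes "det Z \<noteq> 0"
    and S: "((\<lambda>w. Spol a b c (upd Z i j w$1$1) (upd Z i j w$1$2) (upd Z i j w$2$1) (upd Z i j w$2$2))
      has_field_derivative S') (at (Z$i$j))"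
    and N: "((\<lambda>w. det (upd Z i j w)) has_field_derivative N') (at (Z$i$j))"
  shows "((\<lambda>w. eb a b c k (upd Z i j w)) has_field_derivative
     S' * det Z powi k + of_int k * N' * det Z powi (k - 1) * Spol a b c (Z$1$1) (Z$1$2) (Z$2$1) (Z$2$2)) (at (Z$i$j))"
  unfolding eb_def
  by (rule has_derivative_onGL[OF assms(1)], rule DERIV_cong[OF DERIV_mult[OF S DERIV_power_int[OF N]]])
    (use assms(1) in \<open>simp_all add: algebra_simps\<close>)

lemma DERIV_eb:
  assumes "det Z \<noteq> 0"
  defines "S \<equiv> \<lambda>a b c. Spol a b c (Z$1$1) (Z$1$2) (Z$2$1) (Z$2$2)"
  shows "((\<lambda>w. eb a b c k (upd Z 1 1 w)) has_field_derivative
       S (a - 1) b (c - 1) * det Z powi k + of_int k * Z$2$2 * det Z powi (k - 1) * S a b c) (at (Z$1$1))"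
    and "((\<lambda>w. eb a b c k (upd Z 1 2 w)) has_field_derivative
       S a (b - 1) (c - 1) * det Z powi k - of_int k * Z$2$1 * det Z powi (k - 1) * S a b c) (at (Z$1$2))"
    and "((\<lambda>w. eb a b c k (upd Z 2 1 w)) has_field_derivative
       S (a - 1) b c * det Z powi k - of_int k * Z$1$2 * det Z powi (k - 1) * S a b c) (at (Z$2$1))"
    and "((\<lambda>w. eb a b c k (upd Z 2 2 w)) has_field_derivative
       S a (b - 1) c * det Z powi k + of_int k * Z$1$1 * det Z powi (k - 1) * S a b c) (at (Z$2$2))"
  subgoal
    using DERIV_eb_gen[OF assms(1), of a b c 1 1 _ "Z$2$2" k, unfolded det_2 upd_nth, folded det_2]
    unfolding S_def by (rule DERIV_cong) (auto intro!: DERIV_Spol_x derivative_eq_intros)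
  subgoal
    unfolding S_def
    by (rule DERIV_cong, rule DERIV_eb_gen[OF assms(1), where N' = "- (Z$2$1)"])
      (auto simp: det_2 intro!: DERIV_Spol_y derivative_eq_intros)
  subgoal
    unfolding S_def
    by (rule DERIV_cong, rule DERIV_eb_gen[OF assms(1), where N' = "- (Z$1$2)"])
      (auto simp: det_2 intro!: DERIV_Spol_z derivative_eq_intros)
  subgoal
    unfolding S_def
    by (rule DERIV_cong, rule DERIV_eb_gen[OF assms(1), where N' = "Z$1$1"])
      (auto simp: det_2 intro!: DERIV_Spol_w derivative_eq_intros)
  done

text \<open>A certificate format: once the multiplier t is named, the goal follows from a known
  equation by ring normalisation alone.\<close>

lemma eq_by_combination:
  fixes X Y :: "'a::comm_ring_1"
  assumes "A = B" "X - Y = t * (A - B)"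
  shows "X = Y"
  using assms by simp

lemma eq_by_combination2:
  fixes X Y :: "'a::comm_ring_1"
  assumes "A = B" "C = D" "X - Y = (A - B) + (C - D)"
  shows "X = Y"
  using assms by simp

text \<open>These are the polarisation operators on the rows: two measure the degree in a row, two
  move one unit of degree between the rows. Adding the two relevant product formulas cancels their
  N-terms and leaves a + b times the claim.\<close>

lemma euler_Spol:
  shows "x * Spol (a - 1) b (c - 1) x y z w + y * Spol a (b - 1) (c - 1) x y z w =
      of_int c * Spol a b c x y z w" (is ?T1)
    and "z * Spol (a - 1) b c x y z w + w * Spol a (b - 1) c x y z w =
      of_int (a + b - c) * Spol a b c x y z w" (is ?T2)
    and "x * Spol (a - 1) b c x y z w + y * Spol a (b - 1) c x y z w =
      of_int (c + 1) * Spol a b (c + 1) x y z w" (is ?T3)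
    and "z * Spol (a - 1) b (c - 1) x y z w + w * Spol a (b - 1) (c - 1) x y z w =
      of_int (a + b - c + 1) * Spol a b (c - 1) x y z w" (is ?T4)
proof -
  have *: "?T1 \<and> ?T2 \<and> ?T3 \<and> ?T4"
  \<comment> \<open>The common factor a + b cannot be cancelled in degree 0; there every S with
    nonzero third index vanishes, and the remaining coefficients are checked directly.\<close>
  proof (cases "a + b = 0")
    case True
    have v: "Spol a b i x y z w = 0" if "i \<noteq> 0" for i
      using True that by (intro Spol_invalid) linarith
    have "of_int c * Spol a b c x y z w = 0"
      by (cases "c = 0") (simp_all add: v)
    moreover have "of_int (a + b - c) * Spol a b c x y z w = 0"
      by (cases "c = 0") (simp_all add: v True)
    moreover have "of_int (c + 1) * Spol a b (c + 1) x y z w = 0"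
      by (cases "c + 1 = 0") (simp_all add: v)
    moreover have "of_int (a + b - c + 1) * Spol a b (c - 1) x y z w = 0"
      by (cases "c - 1 = 0") (simp_all add: v True)
    moreover have "Spol (a - 1) b i x y z w = 0" "Spol a (b - 1) i x y z w = 0" for i
      using True by (auto intro!: Spol_invalid)
    ultimately show ?thesis by simp
  next
    case False
    then have nz: "complex_of_int (a + b) \<noteq> 0" by (metis of_int_eq_0_iff)
    note cancel = mult_left_cancel[OF nz, THEN iffD1]
    have ?T1
      by (rule cancel, rule eq_by_combination2[OF mult_x_Spol[of "a - 1" b x "c - 1" y z w]
          mult_y_Spol[of a "b - 1" y "c - 1" x z w]]) (simp add: algebra_simps)
    moreover have ?T2
      by (rule cancel, rule eq_by_combination2[OF mult_z_Spol[of "a - 1" b z c x y w]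
          mult_w_Spol[of a "b - 1" w c x y z]]) (simp add: algebra_simps)
    moreover have ?T3
      by (rule cancel, rule eq_by_combination2[OF mult_x_Spol[of "a - 1" b x c y z w]
          mult_y_Spol[of a "b - 1" y c x z w]]) (simp add: algebra_simps)
    moreover have ?T4
      by (rule cancel, rule eq_by_combination2[OF mult_z_Spol[of "a - 1" b z "c - 1" x y w]
          mult_w_Spol[of a "b - 1" w "c - 1" x y z]]) (simp add: algebra_simps)
    ultimately show ?thesis by blast
  qed
  then show ?T1 ?T2 ?T3 ?T4 by blast+
qed

text \<open>Transposing the matrix of exponents exchanges its column sums (a, b) with its row sums
  (c, a + b - c). Column identities are thereby read off from row identities.\<close>

lemma Spol_transpose: "Spol a b c x y z w = Spol c (a + b - c) a x z y w"
proof -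
  define l h where "l = (0::int)" and "h = max 0 (max a c)"
  have "Spol a b c x y z w = (\<Sum>i\<in>{l..h}. divpow x i * divpow y (c - i) * divpow z (a - i)
      * divpow w (b - c + i))"
    by (rule Spol_eq_sum) (auto simp: l_def h_def)
  also have "\<dots> = (\<Sum>i\<in>{l..h}. divpow x i * divpow z (a - i) * divpow y (c - i)
      * divpow w (a + b - c - a + i))"
    by (rule sum.cong) (simp_all add: algebra_simps)
  also have "\<dots> = Spol c (a + b - c) a x z y w"
    by (rule Spol_eq_sum[symmetric]) (auto simp: l_def h_def)
  finally show ?thesis .
qed

lemma euler_Spol_columns:
  shows "x * Spol (a - 1) b (c - 1) x y z w + z * Spol (a - 1) b c x y z w =
      of_int a * Spol a b c x y z w"
    and "y * Spol a (b - 1) (c - 1) x y z w + w * Spol a (b - 1) c x y z w =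
      of_int b * Spol a b c x y z w"
    and "x * Spol a (b - 1) (c - 1) x y z w + z * Spol a (b - 1) c x y z w =
      of_int (a + 1) * Spol (a + 1) (b - 1) c x y z w"
    and "y * Spol (a - 1) b (c - 1) x y z w + w * Spol (a - 1) b c x y z w =
      of_int (b + 1) * Spol (a - 1) (b + 1) c x y z w"
proof -
  note E = euler_Spol[where x = x and y = z and z = y and w = w and a = c and b = "a + b - c" and c = a]
  note T = Spol_transpose[of _ _ _ x y z w]
  show "x * Spol (a - 1) b (c - 1) x y z w + z * Spol (a - 1) b c x y z w =
      of_int a * Spol a b c x y z w"
    unfolding T by (rule eq_by_combination[OF E(1), where t = 1]) (simp add: algebra_simps)
  show "y * Spol a (b - 1) (c - 1) x y z w + w * Spol a (b - 1) c x y z w =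
      of_int b * Spol a b c x y z w"
    unfolding T by (rule eq_by_combination[OF E(2), where t = 1]) (simp add: algebra_simps)
  show "x * Spol a (b - 1) (c - 1) x y z w + z * Spol a (b - 1) c x y z w =
      of_int (a + 1) * Spol (a + 1) (b - 1) c x y z w"
    unfolding T by (rule eq_by_combination[OF E(3), where t = 1]) (simp add: algebra_simps)
  show "y * Spol (a - 1) b (c - 1) x y z w + w * Spol (a - 1) b c x y z w =
      of_int (b + 1) * Spol (a - 1) (b + 1) c x y z w"
    unfolding T by (rule eq_by_combination[OF E(4), where t = 1]) (simp add: algebra_simps)
qed

lemma pd_eb:
  assumes "det Z \<noteq> 0"
  defines "S \<equiv> \<lambda>a b c. Spol a b c (Z$1$1) (Z$1$2) (Z$2$1) (Z$2$2)"
  shows "pd 1 1 (eb a b c k) Z =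
       S (a - 1) b (c - 1) * det Z powi k + of_int k * Z$2$2 * det Z powi (k - 1) * S a b c"
    and "pd 1 2 (eb a b c k) Z =
       S a (b - 1) (c - 1) * det Z powi k - of_int k * Z$2$1 * det Z powi (k - 1) * S a b c"
    and "pd 2 1 (eb a b c k) Z =
       S (a - 1) b c * det Z powi k - of_int k * Z$1$2 * det Z powi (k - 1) * S a b c"
    and "pd 2 2 (eb a b c k) Z =
       S a (b - 1) c * det Z powi k + of_int k * Z$1$1 * det Z powi (k - 1) * S a b c"
  unfolding pd_eq_deriv_upd S_def using DERIV_eb[OF assms(1), THEN DERIV_imp_deriv] by blast+

lemma eb_apply: "det Z \<noteq> 0 \<Longrightarrow> eb a b c k Z =
    Spol a b c (Z$1$1) (Z$1$2) (Z$2$1) (Z$2$2) * det Z powi k"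
  by (simp add: eb_def onGL_def)

lemma eb_singular: "det Z = 0 \<Longrightarrow> eb a b c k Z = 0"
  by (simp add: eb_def onGL_def)

lemma eb_invalid: "a < 0 \<or> b < 0 \<or> c < 0 \<or> a + b < c \<Longrightarrow> eb a b c k = (\<lambda>Z. 0)"
  by (auto simp: eb_def onGL_def Spol_invalid)

lemma mult_eb:
  shows "of_int (a + b + 1) * (Z$1$1 * eb a b c k Z) =
      of_int ((c + 1) * (a + 1)) * eb (a + 1) b (c + 1) k Z + eb a (b - 1) c (k + 1) Z"
    and "of_int (a + b + 1) * (Z$1$2 * eb a b c k Z) =
      of_int ((c + 1) * (b + 1)) * eb a (b + 1) (c + 1) k Z - eb (a - 1) b c (k + 1) Z"
    and "of_int (a + b + 1) * (Z$2$1 * eb a b c k Z) =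
      of_int ((a + b - c + 1) * (a + 1)) * eb (a + 1) b c k Z - eb a (b - 1) (c - 1) (k + 1) Z"
    and "of_int (a + b + 1) * (Z$2$2 * eb a b c k Z) =
      of_int ((a + b - c + 1) * (b + 1)) * eb a (b + 1) c k Z + eb (a - 1) b (c - 1) (k + 1) Z"
proof -
  let ?x = "Z$1$1" and ?y = "Z$1$2" and ?z = "Z$2$1" and ?w = "Z$2$2"
  note M = mult_x_Spol[of a b ?x c ?y ?z ?w] mult_y_Spol[of a b ?y c ?x ?z ?w]
    mult_z_Spol[of a b ?z c ?x ?y ?w] mult_w_Spol[of a b ?w c ?x ?y ?z]
  note M' = M[THEN arg_cong[where f = "\<lambda>t. t * det Z powi k"], folded det_2]
  have pw: "det Z powi (k + 1) = det Z * det Z powi k" if "det Z \<noteq> 0"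
    using that by (simp add: power_int_add_1')
  show "of_int (a + b + 1) * (Z$1$1 * eb a b c k Z) =
      of_int ((c + 1) * (a + 1)) * eb (a + 1) b (c + 1) k Z + eb a (b - 1) c (k + 1) Z"
  proof (cases "det Z = 0")
    case False
    from M'(1) show ?thesis
      unfolding eb_apply[OF False] pw[OF False] left_diff_distrib distrib_right by (simp only: mult_ac)
  qed (simp add: eb_singular)
  show "of_int (a + b + 1) * (Z$1$2 * eb a b c k Z) =
      of_int ((c + 1) * (b + 1)) * eb a (b + 1) (c + 1) k Z - eb (a - 1) b c (k + 1) Z"
  proof (cases "det Z = 0")
    case False
    from M'(2) show ?thesis
      unfolding eb_apply[OF False] pw[OF False] left_diff_distrib distrib_right by (simp only: mult_ac)
  qed (simp add: eb_singular)
  show "of_int (a + b + 1) * (Z$2$1 * eb a b c k Z) =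
      of_int ((a + b - c + 1) * (a + 1)) * eb (a + 1) b c k Z - eb a (b - 1) (c - 1) (k + 1) Z"
  proof (cases "det Z = 0")
    case False
    from M'(3) show ?thesis
      unfolding eb_apply[OF False] pw[OF False] left_diff_distrib distrib_right by (simp only: mult_ac)
  qed (simp add: eb_singular)
  show "of_int (a + b + 1) * (Z$2$2 * eb a b c k Z) =
      of_int ((a + b - c + 1) * (b + 1)) * eb a (b + 1) c k Z + eb (a - 1) b (c - 1) (k + 1) Z"
  proof (cases "det Z = 0")
    case False
    from M'(4) show ?thesis
      unfolding eb_apply[OF False] pw[OF False] left_diff_distrib distrib_right by (simp only: mult_ac)
  qed (simp add: eb_singular)
qed

text \<open>The derivative of N^k contributes k times the cofactor entry times S N^(k-1). Expanding
  this product by \<open>mult_eb\<close> yields one term on the level above and one multiple of the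
  term already produced by differentiating S; the two add up to a + b + 1 + k.\<close>

lemma pd_eb_expand:
  assumes "det Z \<noteq> 0"
  shows "of_int (a + b + 1) * pd 1 1 (eb a b c k) Z = of_int (a + b + 1 + k) * eb (a - 1) b (c - 1) k Z
      + of_int (k * (a + b - c + 1) * (b + 1)) * eb a (b + 1) c (k - 1) Z"
    and "of_int (a + b + 1) * pd 1 2 (eb a b c k) Z = of_int (a + b + 1 + k) * eb a (b - 1) (c - 1) k Z
      - of_int (k * (a + b - c + 1) * (a + 1)) * eb (a + 1) b c (k - 1) Z"
    and "of_int (a + b + 1) * pd 2 1 (eb a b c k) Z = of_int (a + b + 1 + k) * eb (a - 1) b c k Z
      - of_int (k * (c + 1) * (b + 1)) * eb a (b + 1) (c + 1) (k - 1) Z"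
    and "of_int (a + b + 1) * pd 2 2 (eb a b c k) Z = of_int (a + b + 1 + k) * eb a (b - 1) c k Z
      + of_int (k * (c + 1) * (a + 1)) * eb (a + 1) b (c + 1) (k - 1) Z"
proof -
  note P = pd_eb[OF assms, of a b c k, folded eb_apply[OF assms]]
  have P': "pd 1 1 (eb a b c k) Z = eb (a - 1) b (c - 1) k Z + of_int k * (Z$2$2 * eb a b c (k - 1) Z)"
    "pd 1 2 (eb a b c k) Z = eb a (b - 1) (c - 1) k Z - of_int k * (Z$2$1 * eb a b c (k - 1) Z)"
    "pd 2 1 (eb a b c k) Z = eb (a - 1) b c k Z - of_int k * (Z$1$2 * eb a b c (k - 1) Z)"
    "pd 2 2 (eb a b c k) Z = eb a (b - 1) c k Z + of_int k * (Z$1$1 * eb a b c (k - 1) Z)"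
    unfolding P by (simp_all add: eb_apply[OF assms] mult_ac)
  note M = mult_eb[where k = "k - 1" and a = a and b = b and c = c and Z = Z]
  show "of_int (a + b + 1) * pd 1 1 (eb a b c k) Z = of_int (a + b + 1 + k) * eb (a - 1) b (c - 1) k Z
      + of_int (k * (a + b - c + 1) * (b + 1)) * eb a (b + 1) c (k - 1) Z"
    unfolding P' by (rule eq_by_combination[OF M(4), where t = "of_int k"]) (simp add: algebra_simps)
  show "of_int (a + b + 1) * pd 1 2 (eb a b c k) Z = of_int (a + b + 1 + k) * eb a (b - 1) (c - 1) k Z
      - of_int (k * (a + b - c + 1) * (a + 1)) * eb (a + 1) b c (k - 1) Z"
    unfolding P' by (rule eq_by_combination[OF M(3), where t = "- of_int k"]) (simp add: algebra_simps)
  show "of_int (a + b + 1) * pd 2 1 (eb a b c k) Z = of_int (a + b + 1 + k) * eb (a - 1) b c k Z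
      - of_int (k * (c + 1) * (b + 1)) * eb a (b + 1) (c + 1) (k - 1) Z"
    unfolding P' by (rule eq_by_combination[OF M(2), where t = "- of_int k"]) (simp add: algebra_simps)
  show "of_int (a + b + 1) * pd 2 2 (eb a b c k) Z = of_int (a + b + 1 + k) * eb a (b - 1) c k Z
      + of_int (k * (c + 1) * (a + 1)) * eb (a + 1) b (c + 1) (k - 1) Z"
    unfolding P' by (rule eq_by_combination[OF M(1), where t = "of_int k"]) (simp add: algebra_simps)
qed

text \<open>The degree operators multiply N by 1, which adds k to the eigenvalue, whereas the mixed
  operators annihilate N. Hence all eight preserve both a + b and k.\<close>

lemma euler_eb:
  fixes a b c k :: int
  assumes "det Z \<noteq> 0"
  defines "P \<equiv> \<lambda>i j. pd i j (eb a b c k) Z"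
  shows "Z$1$1 * P 1 1 + Z$1$2 * P 1 2 = of_int (c + k) * eb a b c k Z"
    and "Z$2$1 * P 2 1 + Z$2$2 * P 2 2 = of_int (a + b - c + k) * eb a b c k Z"
    and "Z$1$1 * P 2 1 + Z$1$2 * P 2 2 = of_int (c + 1) * eb a b (c + 1) k Z"
    and "Z$2$1 * P 1 1 + Z$2$2 * P 1 2 = of_int (a + b - c + 1) * eb a b (c - 1) k Z"
    and "Z$1$1 * P 1 1 + Z$2$1 * P 2 1 = of_int (a + k) * eb a b c k Z"
    and "Z$1$2 * P 1 2 + Z$2$2 * P 2 2 = of_int (b + k) * eb a b c k Z"
    and "Z$1$1 * P 1 2 + Z$2$1 * P 2 2 = of_int (a + 1) * eb (a + 1) (b - 1) c k Z"
    and "Z$1$2 * P 1 1 + Z$2$2 * P 2 1 = of_int (b + 1) * eb (a - 1) (b + 1) c k Z"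
proof -
  let ?x = "Z$1$1" and ?y = "Z$1$2" and ?z = "Z$2$1" and ?w = "Z$2$2"
  define q where "q = det Z powi (k - 1)"
  \<comment> \<open>Pulling out N^(k-1) turns each claim into an identity between polynomials,
    namely a multiple of the corresponding identity for S.\<close>
  have q: "det Z powi k = (?x * ?w - ?y * ?z) * q"
    using assms(1) power_int_add_1'[of "det Z" "k - 1"] by (simp add: q_def det_2)
  note E = euler_Spol[where a = a and b = b and c = c and x = ?x and y = ?y and z = ?z and w = ?w]
    euler_Spol_columns[where a = a and b = b and c = c and x = ?x and y = ?y and z = ?z and w = ?w]
  note U = P_def pd_eb[OF assms(1)] eb_apply[OF assms(1)] q q_def[symmetric]
  show "Z$1$1 * P 1 1 + Z$1$2 * P 1 2 = of_int (c + k) * eb a b c k Z"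
    unfolding U by (rule eq_by_combination[OF E(1), where t = "(?x * ?w - ?y * ?z) * q"])
      (simp add: algebra_simps)
  show "Z$2$1 * P 2 1 + Z$2$2 * P 2 2 = of_int (a + b - c + k) * eb a b c k Z"
    unfolding U by (rule eq_by_combination[OF E(2), where t = "(?x * ?w - ?y * ?z) * q"])
      (simp add: algebra_simps)
  show "Z$1$1 * P 2 1 + Z$1$2 * P 2 2 = of_int (c + 1) * eb a b (c + 1) k Z"
    unfolding U by (rule eq_by_combination[OF E(3), where t = "(?x * ?w - ?y * ?z) * q"])
      (simp add: algebra_simps)
  show "Z$2$1 * P 1 1 + Z$2$2 * P 1 2 = of_int (a + b - c + 1) * eb a b (c - 1) k Z"
    unfolding U by (rule eq_by_combination[OF E(4), where t = "(?x * ?w - ?y * ?z) * q"])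
      (simp add: algebra_simps)
  show "Z$1$1 * P 1 1 + Z$2$1 * P 2 1 = of_int (a + k) * eb a b c k Z"
    unfolding U by (rule eq_by_combination[OF E(5), where t = "(?x * ?w - ?y * ?z) * q"])
      (simp add: algebra_simps)
  show "Z$1$2 * P 1 2 + Z$2$2 * P 2 2 = of_int (b + k) * eb a b c k Z"
    unfolding U by (rule eq_by_combination[OF E(6), where t = "(?x * ?w - ?y * ?z) * q"])
      (simp add: algebra_simps)
  show "Z$1$1 * P 1 2 + Z$2$1 * P 2 2 = of_int (a + 1) * eb (a + 1) (b - 1) c k Z"
    unfolding U by (rule eq_by_combination[OF E(7), where t = "(?x * ?w - ?y * ?z) * q"])
      (simp add: algebra_simps)
  show "Z$1$2 * P 1 1 + Z$2$2 * P 2 1 = of_int (b + 1) * eb (a - 1) (b + 1) c k Z"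
    unfolding U by (rule eq_by_combination[OF E(8), where t = "(?x * ?w - ?y * ?z) * q"])
      (simp add: algebra_simps)
qed

section \<open>Linear algebra of function spaces\<close>

lemma csubspace_sum:
  assumes "csubspace W" "finite F" "\<And>i. i \<in> F \<Longrightarrow> g i \<in> W"
  shows "(\<lambda>x. \<Sum>i\<in>F. c i * g i x) \<in> W"
  using assms(2,3)
  by (induction F rule: finite_induct) (use assms(1) in \<open>auto simp: csubspace_def\<close>)

lemma csubspace_add: "csubspace W \<Longrightarrow> f \<in> W \<Longrightarrow> g \<in> W \<Longrightarrow> (\<lambda>x. f x + g x) \<in> W"
  and csubspace_scale: "csubspace W \<Longrightarrow> f \<in> W \<Longrightarrow> (\<lambda>x. c * f x) \<in> W"
  and csubspace_zero: "csubspace W \<Longrightarrow> (\<lambda>x. 0) \<in> W"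
  by (auto simp: csubspace_def)

lemma csubspace_diff:
  assumes "csubspace W" "f \<in> W" "g \<in> W"
  shows "(\<lambda>x. f x - g x) \<in> W"
  using csubspace_add[OF assms(1,2) csubspace_scale[OF assms(1,3), of "-1"]] by simp

lemma csubspace_scaleD:
  assumes "csubspace W" "(\<lambda>x. c * f x) \<in> W" "c \<noteq> 0"
  shows "f \<in> W"
  using csubspace_scale[OF assms(1,2), of "inverse c"] assms(3)
  by (simp add: mult.assoc[symmetric])

lemma cspan_subset: "csubspace W \<Longrightarrow> S \<subseteq> W \<Longrightarrow> cspan S \<subseteq> W"
  unfolding cspan_def by (clarsimp, rule csubspace_sum[where g = "\<lambda>g. g"]) auto

lemma cspanI: "finite T \<Longrightarrow> T \<subseteq> S \<Longrightarrow> (\<lambda>x. \<Sum>g\<in>T. c g * g x) \<in> cspan S"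
  unfolding cspan_def by (rule CollectI, rule exI[of _ T], rule exI[of _ c]) simp

lemma cspanE:
  assumes "f \<in> cspan S"
  obtains T c where "finite T" "T \<subseteq> S" "f = (\<lambda>x. \<Sum>g\<in>T. c g * g x)"
  using assms unfolding cspan_def mem_Collect_eq by (elim exE conjE)

lemma cspan_superset: "S \<subseteq> cspan S"
proof
  fix f assume "f \<in> S"
  then show "f \<in> cspan S"
    using cspanI[of "{f}" S "\<lambda>_. 1"] by simp
qed

lemma csubspace_cspan: "csubspace (cspan S)"
  unfolding csubspace_def
proof (intro conjI ballI allI)
  show "(\<lambda>x. 0) \<in> cspan S"
    using cspanI[of "{}" S] by simp
next
  fix f g assume "f \<in> cspan S" "g \<in> cspan S"
  then obtain T c U d where T: "finite T" "T \<subseteq> S" and f: "f = (\<lambda>x. \<Sum>g\<in>T. c g * g x)"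
    and U: "finite U" "U \<subseteq> S" and g: "g = (\<lambda>x. \<Sum>g\<in>U. d g * g x)"
    by (elim cspanE)
  define e where "e h = (if h \<in> T then c h else 0) + (if h \<in> U then d h else 0)" for h
  have "f x = (\<Sum>h\<in>T \<union> U. (if h \<in> T then c h else 0) * h x)" for x
    unfolding f by (rule sum.mono_neutral_cong_left) (use T U in auto)
  moreover have "g x = (\<Sum>h\<in>T \<union> U. (if h \<in> U then d h else 0) * h x)" for x
    unfolding g by (rule sum.mono_neutral_cong_left) (use T U in auto)
  ultimately have "(\<lambda>x. f x + g x) = (\<lambda>x. \<Sum>h\<in>T \<union> U. e h * h x)"
    unfolding e_def distrib_right sum.distrib by presburger
  then show "(\<lambda>x. f x + g x) \<in> cspan S"
    using cspanI[of "T \<union> U" S e] T U by simp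
next
  fix a f assume "f \<in> cspan S"
  then obtain T c where T: "finite T" "T \<subseteq> S" and f: "f = (\<lambda>x. \<Sum>g\<in>T. c g * g x)"
    by (elim cspanE)
  have "(\<lambda>x. a * f x) = (\<lambda>x. \<Sum>g\<in>T. (a * c g) * g x)"
    unfolding f by (simp only: sum_distrib_left mult.assoc)
  then show "(\<lambda>x. a * f x) \<in> cspan S"
    using cspanI[of T S "\<lambda>g. a * c g"] T by simp
qed

text \<open>One index is chosen for each function in the combination, so that coefficients belong to
  indices rather than to functions.\<close>

lemma cspan_imageE:
  assumes "f \<in> cspan (E ` I)"
  obtains F c where "finite F" "F \<subseteq> I" "f = (\<lambda>x. \<Sum>i\<in>F. c i * E i x)"
proof -
  obtain T c where T: "finite T" "T \<subseteq> E ` I" "f = (\<lambda>x. \<Sum>g\<in>T. c g * g x)"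
    using assms by (rule cspanE)
  then obtain F where F: "F \<subseteq> I" "inj_on E F" "T = E ` F"
    by (auto simp: subset_image_inj)
  show thesis
  proof (rule that[of F "\<lambda>i. c (E i)"])
    show "finite F" using F T(1) by (metis finite_imageD)
    show "f = (\<lambda>x. \<Sum>i\<in>F. c (E i) * E i x)"
      unfolding T(3) F(3) using F(2) by (simp add: sum.reindex)
  qed (fact F(1))
qed

text \<open>Applying \<open>D - \<mu>\<close> for an operator \<open>D\<close> with eigenvalue \<open>\<mu>\<close> on a given basis vector removes
  that vector and rescales the others.\<close>

lemma eigenvector_projection:
  assumes W: "csubspace W"
    and sep: "\<And>i i'. i \<in> I \<Longrightarrow> i' \<in> I \<Longrightarrow> i \<noteq> i' \<Longrightarrow> \<exists>D lam. lam i \<noteq> lam i' \<and> (\<forall>f\<in>W. D f \<in> W) \<and>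
      (\<forall>F c. finite F \<longrightarrow> F \<subseteq> I \<longrightarrow>
        D (\<lambda>x. \<Sum>i\<in>F. c i * E i x) = (\<lambda>x. \<Sum>i\<in>F. c i * lam i * E i x))"
    and F: "finite F" "F \<subseteq> I" and f: "(\<lambda>x. \<Sum>i\<in>F. c i * E i x) \<in> W"
    and i0: "i0 \<in> F" "c i0 \<noteq> 0"
  shows "E i0 \<in> W"
proof -
  \<comment> \<open>The coefficient of \<open>E i0\<close> is kept apart and arbitrary, since each
    elimination of an index m rescales it by the nonzero number lam i0 - lam m.\<close>
  have "finite G \<Longrightarrow> G \<subseteq> I - {i0} \<Longrightarrow> (\<lambda>x. c0 * E i0 x + (\<Sum>i\<in>G. c i * E i x)) \<in> W \<Longrightarrow>
      (\<lambda>x. c0 * E i0 x) \<in> W" for G c c0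
  proof (induction G arbitrary: c c0 rule: finite_induct)
    case empty
    then show ?case by simp
  next
    case (insert m G)
    have mI: "m \<in> I" "i0 \<in> I" "m \<noteq> i0" using insert.prems i0 F by auto
    obtain D lam where D: "lam m \<noteq> lam i0" "\<forall>f\<in>W. D f \<in> W"
      "\<And>F c. finite F \<Longrightarrow> F \<subseteq> I \<Longrightarrow>
        D (\<lambda>x. \<Sum>i\<in>F. c i * E i x) = (\<lambda>x. \<Sum>i\<in>F. c i * lam i * E i x)"
      using sep[OF mI] by blast
    define c' where "c' i = (if i = i0 then c0 else c i)" for i
    let ?H = "insert i0 (insert m G)"
    define f where "f = (\<lambda>x. \<Sum>i\<in>?H. c' i * E i x)"
    have i0G: "i0 \<notin> G" using insert.prems by auto
    have eqG: "(\<Sum>i\<in>G. c' i * g i) = (\<Sum>i\<in>G. c i * g i)" for g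
      using i0G by (intro sum.cong) (auto simp: c'_def)
    have "f = (\<lambda>x. c0 * E i0 x + (\<Sum>i\<in>insert m G. c i * E i x))"
      using insert.hyps i0G mI by (simp add: f_def eqG) (simp add: c'_def)
    then have fW: "f \<in> W" using insert.prems by simp
    have Df: "D f = (\<lambda>x. \<Sum>i\<in>?H. c' i * lam i * E i x)"
      unfolding f_def by (rule D(3)) (use insert.hyps insert.prems mI in auto)
    have "D f \<in> W" using D(2) fW by blast
    from csubspace_add[OF W this csubspace_scale[OF W fW, of "- lam m"]]
    have "(\<lambda>x. (\<Sum>i\<in>?H. c' i * lam i * E i x) + (- lam m) * f x) \<in> W"
      unfolding Df .
    also have "(\<lambda>x. (\<Sum>i\<in>?H. c' i * lam i * E i x) + (- lam m) * f x) =
       (\<lambda>x. \<Sum>i\<in>?H. c' i * ((lam i - lam m) * E i x))"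
      unfolding f_def sum_distrib_left sum.distrib[symmetric]
      by (intro ext sum.cong refl) (simp add: algebra_simps)
    also have "\<dots> = (\<lambda>x. (c0 * (lam i0 - lam m)) * E i0 x +
         (\<Sum>i\<in>G. c i * ((lam i - lam m) * E i x)))"
      using insert.hyps i0G mI by (simp add: eqG) (simp add: c'_def mult.assoc)
    also have "\<dots> = (\<lambda>x. (c0 * (lam i0 - lam m)) * E i0 x +
         (\<Sum>i\<in>G. (c i * (lam i - lam m)) * E i x))"
      by (simp only: mult.assoc)
    finally have "(\<lambda>x. (c0 * (lam i0 - lam m)) * E i0 x) \<in> W"
      by (rule insert.IH[rotated]) (use insert.prems in auto)
    then have "(\<lambda>x. (lam i0 - lam m) * (c0 * E i0 x)) \<in> W" by (simp add: mult_ac)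
    then show ?case by (rule csubspace_scaleD[OF W]) (use D(1) in auto)
  qed
  moreover have "(\<lambda>x. c i0 * E i0 x + (\<Sum>i\<in>F - {i0}. c i * E i x)) \<in> W"
    using f by (simp only: sum.remove[OF F(1) i0(1)])
  ultimately have "(\<lambda>x. c i0 * E i0 x) \<in> W"
    using F by blast
  then show ?thesis by (rule csubspace_scaleD[OF W]) (fact i0(2))
qed

section \<open>The action as a first-order differential operator\<close>

text \<open>The E's are the entries of Z times \<open>dmat f Z\<close>, the F's those of
  \<open>dmat f Z\<close> times Z. Grouping the quadratic C-terms as E times Z leaves bare partial
  derivatives only in the B-terms; everything else is governed by \<open>euler_eb\<close>.\<close>

lemma rho1_eq:
  fixes f :: "complex^2^2 \<Rightarrow> complex"
  assumes "det Z \<noteq> 0"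
  defines "p \<equiv> \<lambda>i j. pd i j f Z"
  shows "rho1 A B C D f Z =
     (let E11 = Z$1$1 * p 1 1 + Z$1$2 * p 1 2; E12 = Z$1$1 * p 2 1 + Z$1$2 * p 2 2;
          E21 = Z$2$1 * p 1 1 + Z$2$2 * p 1 2; E22 = Z$2$1 * p 2 1 + Z$2$2 * p 2 2;
          F11 = Z$1$1 * p 1 1 + Z$2$1 * p 2 1; F12 = Z$1$2 * p 1 1 + Z$2$2 * p 2 1;
          F21 = Z$1$1 * p 1 2 + Z$2$1 * p 2 2; F22 = Z$1$2 * p 1 2 + Z$2$2 * p 2 2
      in - A$1$1 * (E11 + f Z) - A$1$2 * E21 - A$2$1 * E12 - A$2$2 * (E22 + f Z)
         - (B$1$1 * p 1 1 + B$1$2 * p 1 2 + B$2$1 * p 2 1 + B$2$2 * p 2 2)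
         + C$1$1 * (E11 * Z$1$1 + E12 * Z$2$1 + 2 * f Z * Z$1$1)
         + C$1$2 * (E21 * Z$1$1 + E22 * Z$2$1 + 2 * f Z * Z$2$1)
         + C$2$1 * (E11 * Z$1$2 + E12 * Z$2$2 + 2 * f Z * Z$1$2)
         + C$2$2 * (E21 * Z$1$2 + E22 * Z$2$2 + 2 * f Z * Z$2$2)
         + D$1$1 * (F11 + f Z) + D$1$2 * F21 + D$2$1 * F12 + D$2$2 * (F22 + f Z))"
  using assms(1) unfolding rho1_def onGL_def p_def
  by (simp add: mtr_def matrix_matrix_mult_def dmat_def mat_def sum_2 Let_def)
    (simp add: algebra_simps)

lemma rho1_singular: "det Z = 0 \<Longrightarrow> rho1 A B C D f Z = 0"
  by (simp add: rho1_def onGL_def)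

text \<open>Since \<open>deriv\<close> is additive only where derivatives exist, linearity of
  \<open>rho1\<close> has to be restricted to functions differentiable in each entry at invertible
  Z.\<close>

definition pdiffable :: "(complex^2^2 \<Rightarrow> complex) \<Rightarrow> bool" where
  "pdiffable f \<longleftrightarrow> (\<forall>Z i j. det Z \<noteq> 0 \<longrightarrow>
     (\<lambda>w. f (upd Z i j w)) field_differentiable at (Z$i$j))"

lemma pdiffable_eb: "pdiffable (eb a b c k)"
  unfolding pdiffable_def forall_2 field_differentiable_def
  by (intro allI conjI impI exI; erule DERIV_eb)

lemma pd_sum:
  assumes "\<And>i. i \<in> F \<Longrightarrow> pdiffable (g i)" "det Z \<noteq> 0"
  shows "pd r s (\<lambda>Z. \<Sum>i\<in>F. c i * g i Z) Z = (\<Sum>i\<in>F. c i * pd r s (g i) Z)"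
  unfolding pd_eq_deriv_upd
  by (rule DERIV_imp_deriv, rule DERIV_sum, rule DERIV_cmult)
    (use assms in \<open>auto simp: pdiffable_def DERIV_deriv_iff_field_differentiable\<close>)

text \<open>The vector field is Z C Z + Z D - A Z - B, the infinitesimal form of fractional linear
  transformations. All that matters afterwards is that Q and P do not depend on f, which makes the
  action commute with finite sums.\<close>

lemma rho1_first_order:
  obtains Q P where "\<And>f Z. det Z \<noteq> 0 \<Longrightarrow> rho1 A B C D f Z = Q Z * f Z +
    (\<Sum>i\<in>UNIV. \<Sum>j\<in>UNIV. P i j Z * pd i j f Z)"
proof
  fix f Z assume "det (Z::complex^2^2) \<noteq> 0"
  then show "rho1 A B C D f Z = (\<lambda>Z. mtr D - mtr A + 2 * mtr (C ** Z)) Z * f Z +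
    (\<Sum>i\<in>UNIV. \<Sum>j\<in>UNIV. (\<lambda>i j Z. (Z ** C ** Z + Z ** D - A ** Z - B) $ i $ j) i j Z * pd i j f Z)"
    by (simp add: rho1_eq Let_def mtr_def matrix_matrix_mult_def sum_2) (simp add: algebra_simps)
qed

lemma rho1_sum:
  assumes "\<And>i. i \<in> F \<Longrightarrow> pdiffable (g i)"
  shows "rho1 A B C D (\<lambda>Z. \<Sum>i\<in>F. c i * g i Z) = (\<lambda>Z. \<Sum>i\<in>F. c i * rho1 A B C D (g i) Z)"
proof
  fix Z
  obtain Q P where QP: "\<And>f Z. det (Z::complex^2^2) \<noteq> 0 \<Longrightarrow> rho1 A B C D f Z = Q Z * f Z +
    (\<Sum>i\<in>UNIV. \<Sum>j\<in>UNIV. P i j Z * pd i j f Z)" using rho1_first_order[of A B C D] by blast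
  show "rho1 A B C D (\<lambda>Z. \<Sum>i\<in>F. c i * g i Z) Z = (\<Sum>i\<in>F. c i * rho1 A B C D (g i) Z)"
  proof (cases "det Z = 0")
    case False
    then show ?thesis
      by (simp add: QP pd_sum[OF assms False] sum_2 sum_distrib_left sum.distrib ring_distribs mult_ac)
  qed (simp add: rho1_singular)
qed

section \<open>The action on basis vectors\<close>

text \<open>The left sides are, up to a + b + 1, the entries of Z (df) Z + 2 Z f after the row
  identities of \<open>euler_eb\<close>. In the first one the upward terms combine by (c+k+2) +
  (a+b-c) = a+b+k+2 and the downward ones by (c+k+2) - (c+1) = k+1; the others are
  analogous.\<close>

lemma quadratic_action_eb:
  fixes Z :: "complex^2^2"
  defines "e \<equiv> \<lambda>a b c k. eb a b c k Z"
  shows "of_int (a + b + 1) * (of_int (c + k + 2) * (Z$1$1 * e a b c k)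
        + of_int (c + 1) * (Z$2$1 * e a b (c + 1) k)) =
      of_int (a + b + k + 2) * (of_int ((c + 1) * (a + 1)) * e (a + 1) b (c + 1) k)
        + of_int (k + 1) * e a (b - 1) c (k + 1)"
    and "of_int (a + b + 1) * (of_int (c + k + 2) * (Z$1$2 * e a b c k)
        + of_int (c + 1) * (Z$2$2 * e a b (c + 1) k)) =
      of_int (a + b + k + 2) * (of_int ((c + 1) * (b + 1)) * e a (b + 1) (c + 1) k)
        - of_int (k + 1) * e (a - 1) b c (k + 1)"
    and "of_int (a + b + 1) * (of_int (a + b - c + k + 2) * (Z$2$1 * e a b c k)
        + of_int (a + b - c + 1) * (Z$1$1 * e a b (c - 1) k)) =
      of_int (a + b + k + 2) * (of_int ((a + b - c + 1) * (a + 1)) * e (a + 1) b c k)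
        - of_int (k + 1) * e a (b - 1) (c - 1) (k + 1)"
    and "of_int (a + b + 1) * (of_int (a + b - c + k + 2) * (Z$2$2 * e a b c k)
        + of_int (a + b - c + 1) * (Z$1$2 * e a b (c - 1) k)) =
      of_int (a + b + k + 2) * (of_int ((a + b - c + 1) * (b + 1)) * e a (b + 1) c k)
        + of_int (k + 1) * e (a - 1) b (c - 1) (k + 1)"
proof -
  have comb: "n * (p * x + q * y) = r" if "n * x = x'" "n * y = y'" "p * x' + q * y' = r"
    for n p q x y x' y' r :: complex
    using that by (auto simp: algebra_simps)
  note m = mult_eb[where a = a and b = b and k = k and Z = Z]
  show "of_int (a + b + 1) * (of_int (c + k + 2) * (Z$1$1 * e a b c k)
        + of_int (c + 1) * (Z$2$1 * e a b (c + 1) k)) =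
      of_int (a + b + k + 2) * (of_int ((c + 1) * (a + 1)) * e (a + 1) b (c + 1) k)
        + of_int (k + 1) * e a (b - 1) c (k + 1)"
    unfolding e_def by (rule comb[OF m(1)[of c] m(3)[of "c + 1"]]) (simp add: algebra_simps)
  show "of_int (a + b + 1) * (of_int (c + k + 2) * (Z$1$2 * e a b c k)
        + of_int (c + 1) * (Z$2$2 * e a b (c + 1) k)) =
      of_int (a + b + k + 2) * (of_int ((c + 1) * (b + 1)) * e a (b + 1) (c + 1) k)
        - of_int (k + 1) * e (a - 1) b c (k + 1)"
    unfolding e_def by (rule comb[OF m(2)[of c] m(4)[of "c + 1"]]) (simp add: algebra_simps)
  show "of_int (a + b + 1) * (of_int (a + b - c + k + 2) * (Z$2$1 * e a b c k)
        + of_int (a + b - c + 1) * (Z$1$1 * e a b (c - 1) k)) =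
      of_int (a + b + k + 2) * (of_int ((a + b - c + 1) * (a + 1)) * e (a + 1) b c k)
        - of_int (k + 1) * e a (b - 1) (c - 1) (k + 1)"
    unfolding e_def by (rule comb[OF m(3)[of c] m(1)[of "c - 1"]]) (simp add: algebra_simps)
  show "of_int (a + b + 1) * (of_int (a + b - c + k + 2) * (Z$2$2 * e a b c k)
        + of_int (a + b - c + 1) * (Z$1$2 * e a b (c - 1) k)) =
      of_int (a + b + k + 2) * (of_int ((a + b - c + 1) * (b + 1)) * e a (b + 1) c k)
        + of_int (k + 1) * e (a - 1) b (c - 1) (k + 1)"
    unfolding e_def by (rule comb[OF m(4)[of c] m(2)[of "c - 1"]]) (simp add: algebra_simps)
qed

text \<open>The components of \<open>\<rho>\<^sub>1\<close> applied to a basis vector with \<open>j = a + b\<close>: \<open>act_level\<close> preserves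
  \<open>(j, k)\<close>, and the other four lead to \<open>(j - 1, k)\<close>, \<open>(j + 1, k - 1)\<close>, \<open>(j + 1, k)\<close>
  and \<open>(j - 1, k + 1)\<close>.\<close>

definition act_level where
  "act_level A D a b c k Z =
     (of_int (a + k + 1) * D$1$1 + of_int (b + k + 1) * D$2$2
       - of_int (c + k + 1) * A$1$1 - of_int (a + b - c + k + 1) * A$2$2) * eb a b c k Z
     + (- of_int (a + b - c + 1) * A$1$2) * eb a b (c - 1) k Z
     + (- of_int (c + 1) * A$2$1) * eb a b (c + 1) k Z
     + (of_int (a + 1) * D$1$2) * eb (a + 1) (b - 1) c k Z
     + (of_int (b + 1) * D$2$1) * eb (a - 1) (b + 1) c k Z"

definition act_B1 where
  "act_B1 B a b c k Z =
     (- B$1$1) * eb (a - 1) b (c - 1) k Z + (- B$1$2) * eb a (b - 1) (c - 1) k Z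
     + (- B$2$1) * eb (a - 1) b c k Z + (- B$2$2) * eb a (b - 1) c k Z"

definition act_B2 where
  "act_B2 B a b c k Z =
     (- of_int ((a + b - c + 1) * (b + 1)) * B$1$1) * eb a (b + 1) c (k - 1) Z
     + (of_int ((a + b - c + 1) * (a + 1)) * B$1$2) * eb (a + 1) b c (k - 1) Z
     + (of_int ((c + 1) * (b + 1)) * B$2$1) * eb a (b + 1) (c + 1) (k - 1) Z
     + (- of_int ((c + 1) * (a + 1)) * B$2$2) * eb (a + 1) b (c + 1) (k - 1) Z"

definition act_C1 where
  "act_C1 C a b c k Z =
     (of_int ((c + 1) * (a + 1)) * C$1$1) * eb (a + 1) b (c + 1) k Z
     + (of_int ((a + b - c + 1) * (a + 1)) * C$1$2) * eb (a + 1) b c k Z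
     + (of_int ((c + 1) * (b + 1)) * C$2$1) * eb a (b + 1) (c + 1) k Z
     + (of_int ((a + b - c + 1) * (b + 1)) * C$2$2) * eb a (b + 1) c k Z"

definition act_C2 where
  "act_C2 C a b c k Z =
     C$1$1 * eb a (b - 1) c (k + 1) Z + (- C$1$2) * eb a (b - 1) (c - 1) (k + 1) Z
     + (- C$2$1) * eb (a - 1) b c (k + 1) Z + C$2$2 * eb (a - 1) b (c - 1) (k + 1) Z"

lemma rho1_eb:
  assumes "0 \<le> a + b"
  shows "rho1 A B C D (eb a b c k) = (\<lambda>Z. act_level A D a b c k Z + inverse (of_int (a + b + 1)) *
     (of_int (a + b + 1 + k) * act_B1 B a b c k Z + of_int k * act_B2 B a b c k Z
      + of_int (a + b + k + 2) * act_C1 C a b c k Z + of_int (k + 1) * act_C2 C a b c k Z))"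
    (is "_ = (\<lambda>Z. act_level A D a b c k Z + inverse ?n * ?R Z)")
proof
  fix Z
  have n: "?n \<noteq> 0" using assms by (metis of_int_eq_0_iff add_nonneg_eq_0_iff zero_neq_one zero_le_one)
  show "rho1 A B C D (eb a b c k) Z = act_level A D a b c k Z + inverse ?n * ?R Z"
  proof (cases "det Z = 0")
    case True
    then show ?thesis
      by (simp add: rho1_singular act_level_def act_B1_def act_B2_def act_C1_def act_C2_def eb_singular)
  next
    case False
    note E = euler_eb[OF False, of a b c k]
    let ?f = "eb a b c k Z"
    define p where "p i j = pd i j (eb a b c k) Z" for i j
    \<comment> \<open>Each \<open>mij\<close> is the (i, j) entry of Z (df) Z + 2 Z f. The trace
      pairs it with the (j, i) entry of C, which is why \<open>m21\<close> later multiplies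
      \<open>C$1$2\<close>.\<close>
    define m11 where "m11 = of_int (c + k + 2) * (Z$1$1 * eb a b c k Z)
        + of_int (c + 1) * (Z$2$1 * eb a b (c + 1) k Z)"
    define m12 where "m12 = of_int (c + k + 2) * (Z$1$2 * eb a b c k Z)
        + of_int (c + 1) * (Z$2$2 * eb a b (c + 1) k Z)"
    define m21 where "m21 = of_int (a + b - c + k + 2) * (Z$2$1 * eb a b c k Z)
        + of_int (a + b - c + 1) * (Z$1$1 * eb a b (c - 1) k Z)"
    define m22 where "m22 = of_int (a + b - c + k + 2) * (Z$2$2 * eb a b c k Z)
        + of_int (a + b - c + 1) * (Z$1$2 * eb a b (c - 1) k Z)"
    define rB where "rB = B$1$1 * p 1 1 + B$1$2 * p 1 2 + B$2$1 * p 2 1 + B$2$2 * p 2 2"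
    define rC where "rC = C$1$1 * m11 + C$1$2 * m21 + C$2$1 * m12 + C$2$2 * m22"
    have "rho1 A B C D (eb a b c k) Z = act_level A D a b c k Z - rB + rC"
      unfolding rho1_eq[OF False] Let_def E act_level_def rB_def rC_def p_def m11_def m12_def m21_def m22_def
      by (simp add: algebra_simps)
    also have "\<dots> = act_level A D a b c k Z + inverse ?n * (?n * (rC - rB))"
      using n by simp
    also have "?n * (rC - rB) = ?R Z"
    proof -
      have B: "?n * rB = - (of_int (a + b + 1 + k) * act_B1 B a b c k Z + of_int k * act_B2 B a b c k Z)"
      proof -
        have "?n * rB = B$1$1 * (?n * p 1 1) + B$1$2 * (?n * p 1 2) + B$2$1 * (?n * p 2 1) + B$2$2 * (?n * p 2 2)"
          unfolding rB_def by (simp only: ring_distribs mult_ac)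
        also have "\<dots> = - (of_int (a + b + 1 + k) * act_B1 B a b c k Z + of_int k * act_B2 B a b c k Z)"
          unfolding p_def pd_eb_expand[OF False] act_B1_def act_B2_def of_int_mult
          by (simp only: ring_distribs mult_ac add_ac minus_add_distrib mult_minus_left mult_minus_right
              minus_minus diff_conv_add_uminus)
        finally show ?thesis .
      qed
      have C: "?n * rC = of_int (a + b + k + 2) * act_C1 C a b c k Z + of_int (k + 1) * act_C2 C a b c k Z"
      proof -
        have "?n * rC = C$1$1 * (?n * m11) + C$1$2 * (?n * m21) + C$2$1 * (?n * m12) + C$2$2 * (?n * m22)"
          unfolding rC_def by (simp only: ring_distribs mult_ac)
        also have "\<dots> = of_int (a + b + k + 2) * act_C1 C a b c k Z + of_int (k + 1) * act_C2 C a b c k Z"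
          unfolding m11_def m12_def m21_def m22_def quadratic_action_eb act_C1_def act_C2_def of_int_mult
          by (simp only: ring_distribs mult_ac add_ac minus_add_distrib mult_minus_left mult_minus_right
              minus_minus diff_conv_add_uminus)
        finally show ?thesis .
      qed
      show ?thesis unfolding right_diff_distrib B C by simp
    qed
    finally show ?thesis .
  qed
qed

definition Em :: "2 \<Rightarrow> 2 \<Rightarrow> complex^2^2" where
  "Em i j = (\<chi> r s. if r = i \<and> s = j then 1 else 0)"

lemma Em_nth [simp]: "Em i j $ r $ s = (if r = i \<and> s = j then 1 else 0)"
  by (simp add: Em_def)

lemmas act_defs = act_level_def act_B1_def act_B2_def act_C1_def act_C2_def

lemma rho1_eb_level:
  assumes "0 \<le> a + b"
  shows "rho1 (Em 1 1) 0 0 0 (eb a b c k) = (\<lambda>Z. of_int (- (c + k + 1)) * eb a b c k Z)"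
    and "rho1 (Em 2 2) 0 0 0 (eb a b c k) = (\<lambda>Z. of_int (- (a + b - c + k + 1)) * eb a b c k Z)"
    and "rho1 (Em 1 2) 0 0 0 (eb a b c k) = (\<lambda>Z. of_int (- (a + b - c + 1)) * eb a b (c - 1) k Z)"
    and "rho1 (Em 2 1) 0 0 0 (eb a b c k) = (\<lambda>Z. of_int (- (c + 1)) * eb a b (c + 1) k Z)"
    and "rho1 0 0 0 (Em 1 1) (eb a b c k) = (\<lambda>Z. of_int (a + k + 1) * eb a b c k Z)"
    and "rho1 0 0 0 (Em 1 2) (eb a b c k) = (\<lambda>Z. of_int (a + 1) * eb (a + 1) (b - 1) c k Z)"
    and "rho1 0 0 0 (Em 2 1) (eb a b c k) = (\<lambda>Z. of_int (b + 1) * eb (a - 1) (b + 1) c k Z)"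
  unfolding rho1_eb[OF assms] by (simp_all add: act_defs)

text \<open>Among the matrix units in B and C, the unit E22 in B and the unit E11 in C are those for
  which, at a = c = 0 and b >= 1, neither component is forced to vanish by an invalid index. This
  singles them out for moving between levels from S(0,j,0).\<close>

lemma rho1_eb_B22:
  assumes "0 \<le> a + b"
  shows "rho1 0 (Em 2 2) 0 0 (eb a b c k) = (\<lambda>Z.
      (- of_int (a + b + 1 + k) / of_int (a + b + 1)) * eb a (b - 1) c k Z
    + (- of_int k * of_int ((c + 1) * (a + 1)) / of_int (a + b + 1)) * eb (a + 1) b (c + 1) (k - 1) Z)"
  unfolding rho1_eb[OF assms] by (simp add: act_defs del: of_int_mult of_int_add)
    (simp add: divide_inverse distrib_left right_diff_distrib mult_ac del: of_int_add)

lemma rho1_eb_C11: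
  assumes "0 \<le> a + b"
  shows "rho1 0 0 (Em 1 1) 0 (eb a b c k) = (\<lambda>Z.
      (of_int (a + b + k + 2) * of_int ((c + 1) * (a + 1)) / of_int (a + b + 1)) * eb (a + 1) b (c + 1) k Z
    + (of_int (k + 1) / of_int (a + b + 1)) * eb a (b - 1) c (k + 1) Z)"
  unfolding rho1_eb[OF assms] by (simp add: act_defs del: of_int_mult of_int_add)
    (simp add: divide_inverse distrib_left right_diff_distrib mult_ac del: of_int_add)

section \<open>Joint eigenvalues and separation of the basis vectors\<close>

type_synonym idx = "int \<times> int \<times> int \<times> int"

definition valid_indices :: "idx set" where
  "valid_indices = {(a, b, c, k). 0 \<le> a \<and> 0 \<le> b \<and> 0 \<le> c \<and> c \<le> a + b}"

definition basis :: "idx \<Rightarrow> complex^2^2 \<Rightarrow> complex" where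
  "basis = (\<lambda>(a, b, c, k). eb a b c k)"

lemma basis_simp [simp]: "basis (a, b, c, k) = eb a b c k"
  by (simp add: basis_def)

lemma pdiffable_basis: "pdiffable (basis i)"
  by (cases i) (simp add: pdiffable_eb)

text \<open>The condition is imposed on finite sums rather than on single basis vectors because D is
  an arbitrary map on functions, with no linearity built in.\<close>

definition diagonal_op where
  "diagonal_op D lam \<longleftrightarrow> (\<forall>F c. finite F \<longrightarrow> F \<subseteq> valid_indices \<longrightarrow>
     D (\<lambda>x. \<Sum>i\<in>F. c i * basis i x) = (\<lambda>x. \<Sum>i\<in>F. c i * lam i * basis i x))"

lemma rho1_diagonal:
  assumes "\<And>i. i \<in> valid_indices \<Longrightarrow> rho1 A B C D (basis i) = (\<lambda>Z. lam i * basis i Z)"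
  shows "diagonal_op (rho1 A B C D) lam"
  unfolding diagonal_op_def
proof (intro allI impI)
  fix F c assume F: "F \<subseteq> valid_indices"
  have "rho1 A B C D (\<lambda>x. \<Sum>i\<in>F. c i * basis i x) = (\<lambda>x. \<Sum>i\<in>F. c i * rho1 A B C D (basis i) x)"
    by (rule rho1_sum) (rule pdiffable_basis)
  also have "\<dots> = (\<lambda>x. \<Sum>i\<in>F. c i * lam i * basis i x)"
    by (intro ext sum.cong refl) (use F assms in \<open>auto simp: mult.assoc\<close>)
  finally show "rho1 A B C D (\<lambda>x. \<Sum>i\<in>F. c i * basis i x) =
    (\<lambda>x. \<Sum>i\<in>F. c i * lam i * basis i x)" .
qed

text \<open>The product of the two root vectors of the row action plays the role of its Casimir operator.\<close>

lemma casimir_diagonal: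
  "diagonal_op (\<lambda>f. rho1 (Em 2 1) 0 0 0 (rho1 (Em 1 2) 0 0 0 f))
     (\<lambda>(a, b, c, k). of_int (c * (a + b - c + 1)))"
  unfolding diagonal_op_def
proof (intro allI impI)
  fix F and c :: "idx \<Rightarrow> complex" assume F: "F \<subseteq> valid_indices"
  define d :: "idx \<Rightarrow> complex" where "d = (\<lambda>(a, b, c, k). of_int (- (a + b - c + 1)))"
  define s :: "idx \<Rightarrow> idx" where "s = (\<lambda>(a, b, c, k). (a, b, c - 1, k))"
  have 1: "rho1 (Em 1 2) 0 0 0 (basis i) = (\<lambda>Z. d i * basis (s i) Z)" if "i \<in> F" for i
    using F that by (auto simp: valid_indices_def d_def s_def rho1_eb_level)
  \<comment> \<open>For c = 0 the shifted index is invalid and its function is zero; the formula for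
    the action still applies and produces the matching eigenvalue 0.\<close>
  have 2: "d i * rho1 (Em 2 1) 0 0 0 (basis (s i)) Z =
      (case i of (a, b, c, k) \<Rightarrow> of_int (c * (a + b - c + 1))) * basis i Z" if "i \<in> F" for i Z
    using F that by (auto simp: valid_indices_def d_def s_def rho1_eb_level algebra_simps)
  have "rho1 (Em 1 2) 0 0 0 (\<lambda>x. \<Sum>i\<in>F. c i * basis i x)
      = (\<lambda>x. \<Sum>i\<in>F. c i * rho1 (Em 1 2) 0 0 0 (basis i) x)"
    by (rule rho1_sum) (rule pdiffable_basis)
  also have "\<dots> = (\<lambda>x. \<Sum>i\<in>F. (c i * d i) * basis (s i) x)"
    by (intro ext sum.cong refl) (simp add: 1 mult.assoc)
  finally have "rho1 (Em 2 1) 0 0 0 (rho1 (Em 1 2) 0 0 0 (\<lambda>x. \<Sum>i\<in>F. c i * basis i x)) =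
      rho1 (Em 2 1) 0 0 0 (\<lambda>x. \<Sum>i\<in>F. (c i * d i) * basis (s i) x)" by (rule arg_cong)
  also have "\<dots> = (\<lambda>x. \<Sum>i\<in>F. (c i * d i) * rho1 (Em 2 1) 0 0 0 (basis (s i)) x)"
    by (rule rho1_sum) (rule pdiffable_basis)
  also have "\<dots> = (\<lambda>x. \<Sum>i\<in>F. c i * (case i of (a, b, c, k) \<Rightarrow> of_int (c * (a + b - c + 1))) * basis i x)"
    by (intro ext sum.cong refl) (simp only: mult.assoc 2)
  finally show "rho1 (Em 2 1) 0 0 0 (rho1 (Em 1 2) 0 0 0 (\<lambda>x. \<Sum>i\<in>F. c i * basis i x)) =
    (\<lambda>x. \<Sum>i\<in>F. c i * (case i of (a, b, c, k) \<Rightarrow> of_int (c * (a + b - c + 1))) * basis i x)" .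
qed

text \<open>Fixing c + k and d + k leaves only simultaneous shifts of c and d, along which c (d + 1)
  is strictly increasing for nonnegative c, d.\<close>

lemma weights_separate:
  fixes c c' d d' :: int
  assumes "0 \<le> c" "0 \<le> d" "0 \<le> c'" "0 \<le> d'" "c + k = c' + k'" "d + k = d' + k'"
    and "c * (d + 1) = c' * (d' + 1)"
  shows "k = k'"
proof -
  have False if "0 \<le> x" "0 \<le> y" "0 < n" "(x + n) * (y + n + 1) = x * (y + 1)" for x y n :: int
  proof -
    have "(x + n) * (y + n + 1) = x * (y + 1) + (x * n + n * (y + n + 1))" by (simp add: algebra_simps)
    moreover have "0 \<le> x * n" "0 < n * (y + n + 1)" using that by auto
    ultimately show False using that by linarith
  qed
  note no = this
  show ?thesis
  proof (cases k k' rule: linorder_cases)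
    case less
    have "c = c' + (k' - k)" "d = d' + (k' - k)" using assms by auto
    with no[of c' d' "k' - k"] assms less show ?thesis by simp
  next
    case greater
    have "c' = c + (k - k')" "d' = d + (k - k')" using assms by auto
    with no[of c d "k - k'"] assms greater show ?thesis by simp
  qed
qed

text \<open>The three diagonal matrices determine c + k, a + b - c + k and a + k, hence the index up
  to multiples of the shift (1, 1, 1, -1). The Casimir-type eigenvalue c (a + b - c + 1) removes
  this last ambiguity.\<close>

lemma diagonal_ops_separate:
  assumes W: "rho1_invariant W" and i: "i \<in> valid_indices" "i' \<in> valid_indices" "i \<noteq> i'"
  shows "\<exists>D lam. lam i \<noteq> lam i' \<and> (\<forall>f\<in>W. D f \<in> W) \<and> diagonal_op D lam"
proof (rule ccontr)
  assume neg: "\<not> ?thesis"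
  have same: "lam i = lam i'" if "\<And>f. f \<in> W \<Longrightarrow> D f \<in> W" "diagonal_op D lam" for D lam
    using neg that by blast
  have rho: "rho1 A B C D f \<in> W" if "f \<in> W" for A B C D f
    using W that by (simp add: rho1_invariant_def)
  obtain a b c k where I: "i = (a, b, c, k)" by (cases i)
  obtain a' b' c' k' where I': "i' = (a', b', c', k')" by (cases i')
  have v: "0 \<le> a" "0 \<le> b" "0 \<le> c" "c \<le> a + b" "0 \<le> a'" "0 \<le> b'" "0 \<le> c'" "c' \<le> a' + b'"
    using i by (auto simp: I I' valid_indices_def)
  have "diagonal_op (rho1 (Em 1 1) 0 0 0) (\<lambda>(a, b, c, k). complex_of_int (- (c + k + 1)))"
    by (rule rho1_diagonal) (auto simp: valid_indices_def rho1_eb_level)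
  from same[OF rho this]
  have "(\<lambda>(a, b, c, k). complex_of_int (- (c + k + 1))) i =
      (\<lambda>(a, b, c, k). complex_of_int (- (c + k + 1))) i'"
    .
  then have 1: "c + k = c' + k'" unfolding I I' prod.case of_int_eq_iff by simp
  have "diagonal_op (rho1 (Em 2 2) 0 0 0) (\<lambda>(a, b, c, k). complex_of_int (- (a + b - c + k + 1)))"
    by (rule rho1_diagonal) (auto simp: valid_indices_def rho1_eb_level)
  from same[OF rho this]
  have "(\<lambda>(a, b, c, k). complex_of_int (- (a + b - c + k + 1))) i =
      (\<lambda>(a, b, c, k). complex_of_int (- (a + b - c + k + 1))) i'"
    .
  then have 2: "a + b - c + k = a' + b' - c' + k'" unfolding I I' prod.case of_int_eq_iff by simp
  have "diagonal_op (rho1 0 0 0 (Em 1 1)) (\<lambda>(a, b, c, k). complex_of_int (a + k + 1))"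
    by (rule rho1_diagonal) (auto simp: valid_indices_def rho1_eb_level)
  from same[OF rho this]
  have "(\<lambda>(a, b, c, k). complex_of_int (a + k + 1)) i =
      (\<lambda>(a, b, c, k). complex_of_int (a + k + 1)) i'"
    .
  then have 3: "a + k = a' + k'" unfolding I I' prod.case of_int_eq_iff by simp
  have "(\<lambda>(a, b, c, k). complex_of_int (c * (a + b - c + 1))) i =
      (\<lambda>(a, b, c, k). complex_of_int (c * (a + b - c + 1))) i'"
    by (rule same[OF _ casimir_diagonal]) (intro rho)
  then have 4: "c * (a + b - c + 1) = c' * (a' + b' - c' + 1)"
    unfolding I I' prod.case of_int_eq_iff .
  have "k = k'"
    by (rule weights_separate[of c "a + b - c" c' "a' + b' - c'"]) (use v 1 2 4 in auto)
  with 1 2 3 i(3) show False by (simp add: I I')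
qed

lemma basis_projection:
  assumes "csubspace W" "rho1_invariant W" "finite F" "F \<subseteq> valid_indices"
    and "(\<lambda>x. \<Sum>i\<in>F. c i * basis i x) \<in> W" "i0 \<in> F" "c i0 \<noteq> 0"
  shows "basis i0 \<in> W"
  by (rule eigenvector_projection[OF assms(1) _ assms(3-7)])
    (use diagonal_ops_separate[OF assms(2)] in \<open>simp add: diagonal_op_def\<close>)

lemma eb_zero_or_valid: "eb a b c k = (\<lambda>Z. 0) \<or> (a, b, c, k) \<in> valid_indices"
  using eb_invalid[of a b c k] by (auto simp: valid_indices_def)

text \<open>A generator leading out of a level returns a sum over two neighbouring levels; this
  extracts one of them. If the other index is invalid, its function is zero and nothing has to be
  separated.\<close>

lemma two_term_projection:
  assumes "csubspace W" "rho1_invariant W" "i \<noteq> i'" "i \<in> valid_indices"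
    and mem: "(\<lambda>Z. \<alpha> * basis i Z + \<beta> * basis i' Z) \<in> W" and "\<alpha> \<noteq> 0"
  shows "basis i \<in> W"
proof (cases "i' \<in> valid_indices")
  case True
  show ?thesis
    by (rule basis_projection[OF assms(1,2), of "{i, i'}" "\<lambda>l. if l = i then \<alpha> else \<beta>"])
      (use assms True in auto)
next
  case False
  then have "basis i' = (\<lambda>Z. 0)"
    by (cases i') (use eb_zero_or_valid in auto)
  then have "(\<lambda>Z. \<alpha> * basis i Z) \<in> W" using mem by simp
  then show ?thesis by (rule csubspace_scaleD[OF assms(1)]) (fact assms(6))
qed

section \<open>Moves inside a level\<close>

lemma int_interval_reachable:
  fixes x0 y n :: int
  assumes "P x0" "0 \<le> x0" "x0 \<le> n" "0 \<le> y" "y \<le> n"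
    and up: "\<And>x. 0 \<le> x \<Longrightarrow> x < n \<Longrightarrow> P x \<Longrightarrow> P (x + 1)"
    and down: "\<And>x. 0 < x \<Longrightarrow> x \<le> n \<Longrightarrow> P x \<Longrightarrow> P (x - 1)"
  shows "P y"
proof (cases "x0 \<le> y")
  case True
  then have "y \<le> n \<longrightarrow> P y"
    by (induction y rule: int_ge_induct) (use assms in auto)
  then show ?thesis using assms by simp
next
  case False
  then have "y \<le> x0" by simp
  then have "0 \<le> y \<longrightarrow> P y"
    by (induction y rule: int_le_induct) (use assms in auto)
  then show ?thesis using assms by simp
qed

text \<open>Off-diagonal A moves c up and down, off-diagonal D trades a against b. The factors c +
  1, a + b - c + 1, a + 1 and b + 1 have no zero inside the level, which is thus a single
  irreducible piece for A and D.\<close>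

lemma level_reachable:
  assumes W: "csubspace W" "rho1_invariant W" and "eb a b c k \<in> W"
    and v: "(a, b, c, k) \<in> valid_indices" "(a', b', c', k) \<in> valid_indices" "a' + b' = a + b"
  shows "eb a' b' c' k \<in> W"
proof -
  have rho: "rho1 A B C D f \<in> W" if "f \<in> W" for A B C D f
    using W that by (simp add: rho1_invariant_def)
  define n where "n = a + b"
  have n: "0 \<le> a" "a \<le> n" "0 \<le> c" "c \<le> n" "0 \<le> a'" "a' \<le> n" "0 \<le> c'" "c' \<le> n" "0 \<le> n"
    using v by (auto simp: n_def valid_indices_def)
  have sum: "0 \<le> x + (n - x)" for x using n by simp
  have "eb a (n - a) c' k \<in> W"
  proof (rule int_interval_reachable[where P = "\<lambda>x. eb a (n - a) x k \<in> W", OF _ n(3,4,7,8)])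
    show "eb a (n - a) c k \<in> W" using assms(3) by (simp add: n_def)
    fix x assume "eb a (n - a) x k \<in> W"
    note m = rho[OF this]
    show "eb a (n - a) (x + 1) k \<in> W" if "0 \<le> x"
      by (rule csubspace_scaleD[OF W(1) m[of "Em 2 1" 0 0 0, unfolded rho1_eb_level(4)[OF sum]]])
        (unfold of_int_eq_0_iff, use that in simp)
    show "eb a (n - a) (x - 1) k \<in> W" if "x \<le> n"
      by (rule csubspace_scaleD[OF W(1) m[of "Em 1 2" 0 0 0, unfolded rho1_eb_level(3)[OF sum]]])
        (unfold of_int_eq_0_iff, use that in simp)
  qed
  then have "eb a' (n - a') c' k \<in> W"
  proof (rule int_interval_reachable[where P = "\<lambda>x. eb x (n - x) c' k \<in> W", OF _ n(1,2,5,6)])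
    fix x assume "eb x (n - x) c' k \<in> W"
    note m = rho[OF this]
    have "eb (x + 1) (n - x - 1) c' k \<in> W" if "0 \<le> x"
      by (rule csubspace_scaleD[OF W(1) m[of 0 0 0 "Em 1 2", unfolded rho1_eb_level(6)[OF sum]]])
        (unfold of_int_eq_0_iff, use that in simp)
    then show "eb (x + 1) (n - (x + 1)) c' k \<in> W" if "0 \<le> x"
      using that by (simp add: algebra_simps)
    have "eb (x - 1) (n - x + 1) c' k \<in> W" if "x \<le> n"
      by (rule csubspace_scaleD[OF W(1) m[of 0 0 0 "Em 2 1", unfolded rho1_eb_level(7)[OF sum]]])
        (unfold of_int_eq_0_iff, use that in simp)
    then show "eb (x - 1) (n - (x - 1)) c' k \<in> W" if "x \<le> n"
      using that by (simp add: algebra_simps)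
  qed
  moreover have "n - a' = b'" using v(3) by (simp add: n_def)
  ultimately show ?thesis by simp
qed

section \<open>Invariance and irreducibility of regions\<close>

text \<open>The moves \<open>(j, k) \<mapsto> (j', k')\<close> that occur with a nonzero coefficient in the action.\<close>

definition step_closed :: "(int \<Rightarrow> int \<Rightarrow> bool) \<Rightarrow> bool" where
  "step_closed P \<longleftrightarrow> (\<forall>j k. 0 \<le> j \<longrightarrow> P j k \<longrightarrow>
     (k \<noteq> 0 \<longrightarrow> P (j + 1) (k - 1)) \<and> (1 \<le> j \<and> j + 1 + k \<noteq> 0 \<longrightarrow> P (j - 1) k) \<and>
     (j + k + 2 \<noteq> 0 \<longrightarrow> P (j + 1) k) \<and> (1 \<le> j \<and> k + 1 \<noteq> 0 \<longrightarrow> P (j - 1) (k + 1)))"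

lemma step_closedD:
  assumes "step_closed P" "0 \<le> j" "P j k"
  shows "k \<noteq> 0 \<Longrightarrow> P (j + 1) (k - 1)" "1 \<le> j \<Longrightarrow> j + 1 + k \<noteq> 0 \<Longrightarrow> P (j - 1) k"
    "j + k + 2 \<noteq> 0 \<Longrightarrow> P (j + 1) k" "1 \<le> j \<Longrightarrow> k + 1 \<noteq> 0 \<Longrightarrow> P (j - 1) (k + 1)"
  using assms unfolding step_closed_def by blast+

definition region :: "(int \<Rightarrow> int \<Rightarrow> bool) \<Rightarrow> idx set" where
  "region P = {(a, b, c, k). (a, b, c, k) \<in> valid_indices \<and> P (a + b) k}"

lemma region_subset: "region P \<subseteq> valid_indices"
  by (auto simp: region_def)

text \<open>Membership of f is demanded only when its factor is nonzero; this is the point at which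
  vanishing factors yield invariance.\<close>

lemma csubspace_of_int_scale:
  assumes "csubspace W" "n \<noteq> 0 \<Longrightarrow> f \<in> W"
  shows "(\<lambda>x. of_int n * f x) \<in> W"
  using assms csubspace_zero[OF assms(1)] csubspace_scale[OF assms(1)] by (cases "n = 0") auto

lemma rho1_invariant_region:
  assumes P: "step_closed P"
  shows "rho1_invariant (cspan (basis ` region P))"
proof -
  define V where "V = cspan (basis ` region P)"
  have V: "csubspace V" unfolding V_def by (rule csubspace_cspan)
  \<comment> \<open>The guard 0 <= J covers downward moves from j = 0: there J = -1, the index is
    invalid and the term is zero.\<close>
  have t: "(\<lambda>Z. \<alpha> * eb a b c k Z) \<in> V" if "a + b = J" "0 \<le> J \<Longrightarrow> P J k" for \<alpha> J a b c k
  proof (cases "(a, b, c, k) \<in> valid_indices")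
    case True
    then have "(a, b, c, k) \<in> region P"
      using that by (simp add: region_def valid_indices_def)
    then have "basis (a, b, c, k) \<in> V"
      unfolding V_def by (intro subsetD[OF cspan_superset] imageI)
    from csubspace_scale[OF V this] show ?thesis by simp
  next
    case False
    then have "eb a b c k = (\<lambda>Z. 0)" using eb_zero_or_valid[of a b c k] by blast
    then show ?thesis using csubspace_zero[OF V] by simp
  qed
  have gen: "rho1 A B C D (eb a b c k) \<in> V" if "(a, b, c, k) \<in> region P" for A B C D a b c k
  proof -
    have v: "0 \<le> a" "0 \<le> b" "P (a + b) k" using that by (auto simp: region_def valid_indices_def)
    note st = step_closedD[OF P add_nonneg_nonneg[OF v(1,2)] v(3)]
    have "act_level A D a b c k \<in> V"
      unfolding act_level_def[abs_def]
      by (intro csubspace_add[OF V] t[where J = "a + b"] v(3)) simp_all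
    moreover have "act_B1 B a b c k \<in> V" if "a + b + 1 + k \<noteq> 0"
      unfolding act_B1_def[abs_def]
      by (intro csubspace_add[OF V] t[where J = "a + b - 1"] st(2) that) simp_all
    moreover have "act_B2 B a b c k \<in> V" if "k \<noteq> 0"
      unfolding act_B2_def[abs_def]
      by (intro csubspace_add[OF V] t[where J = "a + b + 1"] st(1) that) simp_all
    moreover have "act_C1 C a b c k \<in> V" if "a + b + k + 2 \<noteq> 0"
      unfolding act_C1_def[abs_def]
      by (intro csubspace_add[OF V] t[where J = "a + b + 1"] st(3) that) simp_all
    moreover have "act_C2 C a b c k \<in> V" if "k + 1 \<noteq> 0"
      unfolding act_C2_def[abs_def]
      by (intro csubspace_add[OF V] t[where J = "a + b - 1"] st(4) that) simp_all
    ultimately have "(\<lambda>Z. act_level A D a b c k Z + inverse (of_int (a + b + 1)) *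
        (of_int (a + b + 1 + k) * act_B1 B a b c k Z + of_int k * act_B2 B a b c k Z
        + of_int (a + b + k + 2) * act_C1 C a b c k Z + of_int (k + 1) * act_C2 C a b c k Z)) \<in> V"
      by - (rule csubspace_add[OF V], assumption, rule csubspace_scale[OF V],
        rule csubspace_add[OF V], rule csubspace_add[OF V], rule csubspace_add[OF V];
        rule csubspace_of_int_scale[OF V], blast)
    then show ?thesis
      unfolding rho1_eb[OF add_nonneg_nonneg[OF v(1,2)]] .
  qed
  have "rho1 A B C D f \<in> V" if f: "f \<in> V" for A B C D f
  proof -
    obtain F c where F: "finite F" "F \<subseteq> region P" and f: "f = (\<lambda>x. \<Sum>i\<in>F. c i * basis i x)"
      using f unfolding V_def by (rule cspan_imageE)
    have "rho1 A B C D f = (\<lambda>Z. \<Sum>i\<in>F. c i * rho1 A B C D (basis i) Z)"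
      unfolding f by (rule rho1_sum) (rule pdiffable_basis)
    moreover have "rho1 A B C D (basis i) \<in> V" if "i \<in> F" for i
      using F(2) that gen by (cases i) auto
    ultimately show ?thesis
      using csubspace_sum[OF V F(1), of "\<lambda>i. rho1 A B C D (basis i)" c] by simp
  qed
  then show ?thesis unfolding rho1_invariant_def V_def by blast
qed

lemma rho1_zero: "rho1 A B C D (\<lambda>Z. 0) = (\<lambda>Z. 0)"
  using rho1_sum[of "{}" "\<lambda>_ _. 0" A B C D "\<lambda>_. 0"] by simp

lemma csubspace_zero_space: "csubspace {\<lambda>x. 0}"
  by (simp add: csubspace_def)

lemma rho1_invariant_zero_space: "rho1_invariant {\<lambda>Z. 0}"
  by (simp add: rho1_invariant_def rho1_zero)

text \<open>If one vector of a level were zero, \<open>level_reachable\<close> in the zero subspace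
  would make S(0,j,0) N^k = w^j / j! N^k zero as well, but its value at the identity matrix is 1 /
  j!.\<close>

lemma eb_nonzero:
  assumes "(a, b, c, k) \<in> valid_indices"
  shows "eb a b c k \<noteq> (\<lambda>Z. 0)"
proof
  assume z: "eb a b c k = (\<lambda>Z. 0)"
  have "eb 0 (a + b) 0 k \<in> {\<lambda>Z. 0}"
    by (rule level_reachable[OF csubspace_zero_space rho1_invariant_zero_space _ assms])
      (use assms z in \<open>auto simp: valid_indices_def\<close>)
  then have "eb 0 (a + b) 0 k (mat 1) = 0" by simp
  then show False
    using assms by (simp add: eb_apply mat_def Spol_one det_2 valid_indices_def)
qed

text \<open>S(0,j,0) N^k serves as the representative of level (j, k). The unit E22 in B and the
  unit E11 in C send it to two neighbouring levels each, and the four components carry exactly the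
  four factors of \<open>step_closed\<close>.\<close>

lemma step_closed_members:
  assumes W: "csubspace W" "rho1_invariant W"
  shows "step_closed (\<lambda>j k. eb 0 j 0 k \<in> W)"
  unfolding step_closed_def
proof (intro allI impI)
  fix j k :: int assume j: "0 \<le> j" and e: "eb 0 j 0 k \<in> W"
  have nz: "complex_of_int (0 + j + 1) \<noteq> 0" unfolding of_int_eq_0_iff using j by simp
  have swap: "(\<lambda>Z. g Z + f Z) \<in> W" if "(\<lambda>Z. f Z + g Z) \<in> W" for f g
    using that by (simp add: add.commute)
  have rho: "rho1 A B C D (eb 0 j 0 k) \<in> W" for A B C D
    using W(2) e by (simp add: rho1_invariant_def)
  have j': "0 \<le> 0 + j" using j by simp
  have B: "(\<lambda>Z. (- of_int (0 + j + 1 + k) / of_int (0 + j + 1)) * basis (0, j - 1, 0, k) Z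
    + (- of_int k * of_int ((0 + 1) * (0 + 1)) / of_int (0 + j + 1)) * basis (0 + 1, j, 0 + 1, k - 1) Z) \<in> W"
    unfolding basis_simp by (rule rho[of 0 "Em 2 2" 0 0, unfolded rho1_eb_B22[OF j']])
  have C: "(\<lambda>Z. (of_int (0 + j + k + 2) * of_int ((0 + 1) * (0 + 1)) / of_int (0 + j + 1)) * basis (0 + 1, j, 0 + 1, k) Z
    + (of_int (k + 1) / of_int (0 + j + 1)) * basis (0, j - 1, 0, k + 1) Z) \<in> W"
    unfolding basis_simp by (rule rho[of 0 0 "Em 1 1" 0, unfolded rho1_eb_C11[OF j']])
  \<comment> \<open>The upward components land on S(1,j,1); this brings them back to the
    representative of level j + 1.\<close>
  have lower: "eb 0 (j + 1) 0 l \<in> W" if "basis (0 + 1, j, 0 + 1, l) \<in> W" for l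
    by (rule level_reachable[OF W that[unfolded basis_simp]]) (use j in \<open>auto simp: valid_indices_def\<close>)
  show "(k \<noteq> 0 \<longrightarrow> eb 0 (j + 1) 0 (k - 1) \<in> W) \<and>
    (1 \<le> j \<and> j + 1 + k \<noteq> 0 \<longrightarrow> eb 0 (j - 1) 0 k \<in> W) \<and>
    (j + k + 2 \<noteq> 0 \<longrightarrow> eb 0 (j + 1) 0 k \<in> W) \<and>
    (1 \<le> j \<and> k + 1 \<noteq> 0 \<longrightarrow> eb 0 (j - 1) 0 (k + 1) \<in> W)"
  proof (intro conjI impI; (elim conjE)?)
    assume "k \<noteq> 0"
    then show "eb 0 (j + 1) 0 (k - 1) \<in> W"
      by (intro lower two_term_projection[OF W _ _ swap[OF B]])
        (use nz j in \<open>auto simp: valid_indices_def\<close>)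
  next
    assume "1 \<le> j" "j + 1 + k \<noteq> 0"
    moreover from this have "complex_of_int (0 + j + 1 + k) \<noteq> 0" unfolding of_int_eq_0_iff by simp
    ultimately have "basis (0, j - 1, 0, k) \<in> W"
      by (intro two_term_projection[OF W _ _ B])
        (use nz in \<open>auto simp: valid_indices_def simp del: of_int_add\<close>)
    then show "eb 0 (j - 1) 0 k \<in> W" by simp
  next
    assume "j + k + 2 \<noteq> 0"
    moreover from this have "complex_of_int (0 + j + k + 2) \<noteq> 0" unfolding of_int_eq_0_iff by simp
    ultimately show "eb 0 (j + 1) 0 k \<in> W"
      by (intro lower two_term_projection[OF W _ _ C]) (use nz j in \<open>auto simp: valid_indices_def\<close>)
  next
    assume "1 \<le> j" "k + 1 \<noteq> 0"
    moreover from this have "complex_of_int (k + 1) \<noteq> 0" unfolding of_int_eq_0_iff by simp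
    ultimately have "basis (0, j - 1, 0, k + 1) \<in> W"
      by (intro two_term_projection[OF W _ _ swap[OF C]]) (use nz in \<open>auto simp: valid_indices_def\<close>)
    then show "eb 0 (j - 1) 0 (k + 1) \<in> W" by simp
  qed
qed

text \<open>This is strong connectivity of a nonempty region under the nonzero moves, phrased with
  closed sets instead of paths. The set of levels whose representative lies in an invariant subspace
  can then be taken as Q directly.\<close>

definition linked :: "(int \<Rightarrow> int \<Rightarrow> bool) \<Rightarrow> bool" where
  "linked P \<longleftrightarrow> (\<exists>j k. 0 \<le> j \<and> P j k) \<and> (\<forall>Q. step_closed Q \<longrightarrow> (\<exists>j k. 0 \<le> j \<and> P j k \<and> Q j k) \<longrightarrow>
     (\<forall>j k. 0 \<le> j \<and> P j k \<longrightarrow> Q j k))"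

lemma rho1_irreducible_region:
  assumes P: "linked P"
  shows "rho1_irreducible (cspan (basis ` region P))"
  unfolding rho1_irreducible_def
proof (intro conjI allI impI)
  obtain j k where jk: "0 \<le> j" "P j k" using P by (auto simp: linked_def)
  then have "(0, j, 0, k) \<in> region P" by (simp add: region_def valid_indices_def)
  then have "basis (0, j, 0, k) \<in> cspan (basis ` region P)"
    by (intro subsetD[OF cspan_superset] imageI)
  moreover have "basis (0, j, 0, k) \<noteq> (\<lambda>Z. 0)"
    unfolding basis_simp using jk by (intro eb_nonzero) (simp add: valid_indices_def)
  ultimately show "cspan (basis ` region P) \<noteq> {\<lambda>Z. 0}" by blast
next
  fix W assume "csubspace W \<and> W \<subseteq> cspan (basis ` region P) \<and> rho1_invariant W"
  then have W: "csubspace W" "rho1_invariant W" and sub: "W \<subseteq> cspan (basis ` region P)" by auto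
  show "W = {\<lambda>Z. 0} \<or> W = cspan (basis ` region P)"
  proof (rule disjCI)
    assume "W \<noteq> cspan (basis ` region P)"
    show "W = {\<lambda>Z. 0}"
    proof (rule ccontr)
      assume "W \<noteq> {\<lambda>Z. 0}"
      then obtain f where f: "f \<in> W" "f \<noteq> (\<lambda>Z. 0)" using csubspace_zero[OF W(1)] by blast
      obtain F c where F: "finite F" "F \<subseteq> region P" and fs: "f = (\<lambda>x. \<Sum>i\<in>F. c i * basis i x)"
        using f(1) sub by (blast elim: cspan_imageE)
      have "\<exists>i\<in>F. c i \<noteq> 0"
      proof (rule ccontr)
        assume "\<not> ?thesis"
        then have "f = (\<lambda>x. 0)" unfolding fs by simp
        with f(2) show False by contradiction
      qed
      then obtain i where i: "i \<in> F" "c i \<noteq> 0" by blast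
      have "basis i \<in> W"
        by (rule basis_projection[OF W F(1) _ f(1)[unfolded fs] i]) (use F region_subset in blast)
      obtain a b c k where I: "i = (a, b, c, k)" by (cases i)
      have r: "(a, b, c, k) \<in> valid_indices" "P (a + b) k" using F i I by (auto simp: region_def)
      have "eb 0 (a + b) 0 k \<in> W"
        by (rule level_reachable[OF W _ r(1)])
          (use r \<open>basis i \<in> W\<close> I in \<open>auto simp: valid_indices_def\<close>)
      then have "\<exists>j k. 0 \<le> j \<and> P j k \<and> eb 0 j 0 k \<in> W"
        using r by (intro exI[of _ "a + b"] exI[of _ k]) (simp add: valid_indices_def)
      then have all: "0 \<le> j \<Longrightarrow> P j k \<Longrightarrow> eb 0 j 0 k \<in> W" for j k
        using P step_closed_members[OF W] unfolding linked_def by blast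
      have "basis l \<in> W" if "l \<in> region P" for l
      proof -
        obtain a b c k where L: "l = (a, b, c, k)" by (cases l)
        have r: "(a, b, c, k) \<in> valid_indices" "P (a + b) k" using that L by (auto simp: region_def)
        then have "eb 0 (a + b) 0 k \<in> W" by (intro all) (simp_all add: valid_indices_def)
        then have "eb a b c k \<in> W"
          by (rule level_reachable[OF W _ _ r(1)]) (use r in \<open>simp_all add: valid_indices_def\<close>)
        then show ?thesis by (simp add: L)
      qed
      then have "cspan (basis ` region P) \<subseteq> W" by (intro cspan_subset[OF W(1)]) auto
      with sub \<open>W \<noteq> cspan (basis ` region P)\<close> show False by blast
    qed
  qed
qed

section \<open>The three regions and their connectivity\<close>

definition P_plus :: "int \<Rightarrow> int \<Rightarrow> bool" where "P_plus j k \<longleftrightarrow> 0 \<le> k"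
definition P_minus :: "int \<Rightarrow> int \<Rightarrow> bool" where "P_minus j k \<longleftrightarrow> k \<le> - (j + 2)"
definition P_zero :: "int \<Rightarrow> int \<Rightarrow> bool" where "P_zero j k \<longleftrightarrow> - (j + 1) \<le> k \<and> k \<le> - 1"

text \<open>Each factor guards one wall: k = 0 blocks the passage from plus to zero, k + 1 = 0 from
  zero to plus, j + k + 2 = 0 from minus to zero, and j + 1 + k = 0 from zero to minus.\<close>

lemma step_closed_regions: "step_closed P_plus" "step_closed P_minus" "step_closed P_zero"
  unfolding step_closed_def P_plus_def P_minus_def P_zero_def by (intro allI impI; linarith)+

text \<open>Connectivity is checked through a hub (j0, k0): every level must lead to it and be
  reachable from it.\<close>

lemma linkedI:
  assumes "0 \<le> j0" "P j0 k0"
    and "\<And>Q j k. step_closed Q \<Longrightarrow> 0 \<le> j \<Longrightarrow> P j k \<Longrightarrow> Q j k \<Longrightarrow> Q j0 k0"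
    and "\<And>Q j k. step_closed Q \<Longrightarrow> 0 \<le> j \<Longrightarrow> P j k \<Longrightarrow> Q j0 k0 \<Longrightarrow> Q j k"
  shows "linked P"
  unfolding linked_def using assms by blast

text \<open>Towards the hub, j is lowered at fixed k, then k drops by the detour (0,k) -> (1,k-1) ->
  (0,k-1). The way back uses (0,k) -> (1,k) -> (0,k+1) and then raises j.\<close>

lemma linked_plus: "linked P_plus"
proof (rule linkedI[of 0 _ 0])
  fix Q and j k :: int assume Q: "step_closed Q" and j: "0 \<le> j" and "P_plus j k"
  then have k: "0 \<le> k" by (simp add: P_plus_def)
  note st = step_closedD[OF Q]
  define n m where "n = nat j" and "m = nat k"
  have nm: "j = int n" "k = int m" using j k by (auto simp: n_def m_def)
  {
    assume "Q j k"
    then have "Q (int n) (int m)" by (simp add: nm)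
    then have "Q 0 (int m)"
    proof (induction n)
      case (Suc n)
      then show ?case using st(2)[of "int (Suc n)" "int m"] by simp
    qed simp
    then show "Q 0 0"
    proof (induction m)
      case (Suc m)
      from Suc.prems have "Q 1 (int m)" using st(1)[of 0 "int (Suc m)"] by simp
      then have "Q 0 (int m)" using st(2)[of 1 "int m"] by simp
      then show ?case by (rule Suc.IH)
    qed simp
  }
  {
    assume "Q 0 0"
    then have "Q 0 (int m)"
    proof (induction m)
      case (Suc m)
      then have "Q 1 (int m)" using st(3)[of 0 "int m"] by simp
      then show ?case using st(4)[of 1 "int m"] by (simp add: add.commute)
    qed simp
    then have "Q (int n) (int m)"
    proof (induction n)
      case (Suc n)
      then show ?case using st(3)[of "int n" "int m"] by (simp add: add.commute)
    qed simp
    then show "Q j k" by (simp add: nm)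
  }
qed (simp_all add: P_plus_def)

text \<open>The route is that of the plus region with the two detours exchanged: (0,k) -> (1,k) ->
  (0,k+1) leads up to k = -2, and (0,k) -> (1,k-1) -> (0,k-1) leads away from it.\<close>

lemma linked_minus: "linked P_minus"
proof (rule linkedI[of 0 _ "-2"])
  fix Q and j k :: int assume Q: "step_closed Q" and j: "0 \<le> j" and "P_minus j k"
  then have k: "k \<le> - (j + 2)" by (simp add: P_minus_def)
  note st = step_closedD[OF Q]
  define n m where "n = nat j" and "m = nat (- k - 2)"
  have nm: "j = int n" "k = - 2 - int m" "n \<le> m" using j k by (auto simp: n_def m_def)
  {
    assume "Q j k"
    then have "Q (int n) (- 2 - int m)" by (simp add: nm)
    then have "Q 0 (- 2 - int m)" using nm(3)
    proof (induction n)
      case (Suc n)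
      then show ?case using st(2)[of "int (Suc n)" "- 2 - int m"] by simp
    qed simp
    then show "Q 0 (- 2)"
    proof (induction m)
      case (Suc m)
      from Suc.prems have "Q 1 (- 2 - int (Suc m))" using st(3)[of 0 "- 2 - int (Suc m)"] by simp
      then have "Q 0 (- 2 - int (Suc m) + 1)" using st(4)[of 1 "- 2 - int (Suc m)"] by simp
      then show ?case by (intro Suc.IH) simp
    qed simp
  }
  {
    assume "Q 0 (- 2)"
    then have "Q 0 (- 2 - int m)"
    proof (induction m)
      case (Suc m)
      then have "Q 1 (- 2 - int m - 1)" using st(1)[of 0 "- 2 - int m"] by simp
      then have "Q 0 (- 2 - int m - 1)" using st(2)[of 1 "- 2 - int m - 1"] by simp
      then show ?case by (simp add: algebra_simps)
    qed simp
    \<comment> \<open>Raising j from i to i + 1 has factor i - m, which is nonzero as long as i < n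
      <= m.\<close>
    then have "Q (int n) (- 2 - int m)" using nm(3)
    proof (induction n)
      case (Suc n)
      then show ?case using st(3)[of "int n" "- 2 - int m"] by (simp add: add.commute)
    qed simp
    then show "Q j k" by (simp add: nm)
  }
qed (simp_all add: P_minus_def)

lemma linked_zero: "linked P_zero"
proof (rule linkedI[of 0 _ "-1"])
  fix Q and j k :: int assume Q: "step_closed Q" and j: "0 \<le> j" and "P_zero j k"
  then have k: "- (j + 1) \<le> k" "k \<le> - 1" by (simp_all add: P_zero_def)
  note st = step_closedD[OF Q]
  \<comment> \<open>These are the distances to the two walls; they turn the region into the quadrant
    n, m >= 0. The moves (j-1,k) and (j-1,k+1) lower n and m with factors n and -m, and their
    reverses have factors that never vanish in the quadrant.\<close>
  define n m where "n = nat (j + 1 + k)" and "m = nat (- 1 - k)"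
  have nm: "j = int n + int m" "k = - 1 - int m" using j k by (auto simp: n_def m_def)
  {
    assume "Q j k"
    then have "Q (int n + int m) (- 1 - int m)" by (simp add: nm)
    then have "Q (int m) (- 1 - int m)"
    proof (induction n)
      case (Suc n)
      then show ?case using st(2)[of "int (Suc n) + int m" "- 1 - int m"] by simp
    qed simp
    then show "Q 0 (- 1)"
    proof (induction m)
      case (Suc m)
      from Suc.prems have "Q (int (Suc m) - 1) (- 1 - int (Suc m) + 1)"
        using st(4)[of "int (Suc m)" "- 1 - int (Suc m)"] by simp
      then show ?case by (intro Suc.IH) simp
    qed simp
  }
  {
    assume "Q 0 (- 1)"
    then have "Q (int m) (- 1 - int m)"
    proof (induction m)
      case (Suc m)
      then have "Q (int m + 1) (- 1 - int m - 1)" using st(1)[of "int m" "- 1 - int m"] by simp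
      then show ?case by (simp add: algebra_simps)
    qed simp
    then have "Q (int n + int m) (- 1 - int m)"
    proof (induction n)
      case (Suc n)
      then have "Q (int n + int m + 1) (- 1 - int m)"
        using st(3)[of "int n + int m" "- 1 - int m"] by simp
      then show ?case by (simp add: algebra_simps)
    qed simp
    then show "Q j k" by (simp add: nm)
  }
qed (simp_all add: P_zero_def)

section \<open>The matrix coefficients as contour integrals\<close>

lemma cis_powi_has_integral:
  "((\<lambda>\<theta>. cis \<theta> powi n) has_integral (if n = 0 then of_real (2 * pi) else 0)) {0..2 * pi}"
proof (cases "n = 0")
  case True
  then show ?thesis
    using has_integral_const_real[of "1::complex" 0 "2 * pi"] by (simp add: scaleR_conv_of_real)
next
  case False
  define F where "F \<theta> = cis (of_int n * \<theta>) / (\<i> * of_int n)" for \<theta>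
  have "((\<lambda>\<theta>. cis (of_int n * \<theta>)) has_integral F (2 * pi) - F 0) {0..2 * pi}"
  proof (rule fundamental_theorem_of_calculus)
    fix x assume "x \<in> {0..2 * pi}"
    have "((\<lambda>\<theta>. cis (of_int n * \<theta>)) has_vector_derivative of_int n *\<^sub>R (\<i> * cis (of_int n * x)))
        (at x within {0..2 * pi})"
      using has_derivative_cis[OF has_derivative_mult_right[OF has_derivative_ident], of "of_int n" x "{0..2 * pi}"]
      unfolding has_vector_derivative_def by (simp add: mult.commute)
    then have "(F has_vector_derivative (of_int n *\<^sub>R (\<i> * cis (of_int n * x))) / (\<i> * of_int n))
        (at x within {0..2 * pi})"
      unfolding F_def by (rule has_vector_derivative_divide)
    then show "(F has_vector_derivative cis (of_int n * x)) (at x within {0..2 * pi})"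
      using False by (simp add: scaleR_conv_of_real)
  qed simp
  moreover have "F (2 * pi) = F 0"
    using cis_multiple_2pi[of "of_int n"] by (simp add: F_def mult.commute)
  ultimately show ?thesis using False by (simp add: cis_power_int)
qed

lemma divpow_nat: "divpow x (int n) = x ^ n / fact n"
  by (simp add: divpow_def)

lemma binomial_term:
  assumes "i \<le> n"
  shows "of_nat (n choose i) * x ^ i * y ^ (n - i) = fact n * (divpow x (int i) * divpow y (int n - int i))"
proof -
  have eq: "int n - int i = int (n - i)" using assms by simp
  show ?thesis
    unfolding eq divpow_nat using assms by (simp add: binomial_fact)
qed

text \<open>Integration against s^(-c) extracts the coefficient of s^c from the product of two
  binomial expansions; rewriting binomial terms by divided powers produces the factor a! b!.\<close>

lemma contour_integral_Spol:
  "integral {0..2 * pi} (\<lambda>\<theta>. (cis \<theta> * x + z) ^ a * (cis \<theta> * y + w) ^ b * cis \<theta> powi (- c)) =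
     of_real (2 * pi) * (fact a * fact b * Spol (int a) (int b) c x y z w)"
proof (rule integral_unique)
  define g where "g n i x y = of_nat (n choose i) * x ^ i * y ^ (n - i)" for n i and x y :: complex
  have binom: "(cis \<theta> * x + y) ^ n = (\<Sum>i\<le>n. g n i x y * cis \<theta> ^ i)" for \<theta> x y n
    by (simp add: binomial_ring g_def power_mult_distrib mult_ac)
  have expand: "(cis \<theta> * x + z) ^ a * (cis \<theta> * y + w) ^ b * cis \<theta> powi (- c) =
      (\<Sum>i\<le>a. \<Sum>l\<le>b. g a i x z * g b l y w * cis \<theta> powi (int i + int l - c))" for \<theta>
    unfolding binom unfolding sum_product unfolding sum_distrib_right
    by (intro sum.cong refl) (simp add: power_int_add power_int_diff power_int_minus divide_inverse mult_ac)
  have "((\<lambda>\<theta>. (cis \<theta> * x + z) ^ a * (cis \<theta> * y + w) ^ b * cis \<theta> powi (- c)) has_integral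
      (\<Sum>i\<le>a. \<Sum>l\<le>b. g a i x z * g b l y w * (if int i + int l - c = 0 then of_real (2 * pi) else 0)))
      {0..2 * pi}"
    unfolding expand
    by (intro has_integral_sum finite_atMost has_integral_mult_right cis_powi_has_integral)
  also have "(\<Sum>i\<le>a. \<Sum>l\<le>b. g a i x z * g b l y w * (if int i + int l - c = 0 then of_real (2 * pi) else 0)) =
      (\<Sum>i\<le>a. of_real (2 * pi) * (fact a * fact b * (divpow x (int i) * divpow y (c - int i)
         * divpow z (int a - int i) * divpow w (int b - c + int i))))"
  proof (rule sum.cong)
    fix i assume i: "i \<in> {..a}"
    have inner: "(\<Sum>l\<le>b. g b l y w * (if int i + int l - c = 0 then of_real (2 * pi) else 0)) =
       of_real (2 * pi) * (fact b * (divpow y (c - int i) * divpow w (int b - c + int i)))"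
    \<comment> \<open>Only l = c - i survives the integration. If it is outside 0..b, no term
      survives, and one of the two divided powers has a negative exponent.\<close>
    proof (cases "0 \<le> c - int i \<and> c - int i \<le> int b")
      case True
      define m where "m = nat (c - int i)"
      have m: "c = int i + int m" "m \<le> b" using True by (auto simp: m_def)
      have "(\<Sum>l\<le>b. g b l y w * (if int i + int l - c = 0 then of_real (2 * pi) else 0)) =
          (\<Sum>l\<le>b. if l = m then g b m y w * of_real (2 * pi) else 0)"
        by (intro sum.cong) (auto simp: m)
      also have "\<dots> = of_real (2 * pi) * g b m y w" using m by simp
      also have "g b m y w = fact b * (divpow y (int m) * divpow w (int b - int m))"
        unfolding g_def by (rule binomial_term) (fact m)
      finally show ?thesis by (simp add: m)
    next
      case False
      then have "divpow y (c - int i) * divpow w (int b - c + int i) = 0" by auto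
      moreover have "(\<Sum>l\<le>b. g b l y w * (if int i + int l - c = 0 then of_real (2 * pi) else 0)) = 0"
        using False by (intro sum.neutral) auto
      ultimately show ?thesis by simp
    qed
    have outer: "g a i x z = fact a * (divpow x (int i) * divpow z (int a - int i))"
      unfolding g_def by (rule binomial_term) (use i in simp)
    have "(\<Sum>l\<le>b. g a i x z * g b l y w * (if int i + int l - c = 0 then of_real (2 * pi) else 0)) =
       g a i x z * (\<Sum>l\<le>b. g b l y w * (if int i + int l - c = 0 then of_real (2 * pi) else 0))"
      by (simp only: sum_distrib_left mult.assoc)
    then show "(\<Sum>l\<le>b. g a i x z * g b l y w * (if int i + int l - c = 0 then of_real (2 * pi) else 0)) =
       of_real (2 * pi) * (fact a * fact b * (divpow x (int i) * divpow y (c - int i)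
         * divpow z (int a - int i) * divpow w (int b - c + int i)))"
      unfolding inner outer by (simp only: mult_ac)
  qed simp
  also have "\<dots> = of_real (2 * pi) * (fact a * fact b * (\<Sum>i\<le>a. divpow x (int i) * divpow y (c - int i)
         * divpow z (int a - int i) * divpow w (int b - c + int i)))"
    by (simp only: sum_distrib_left)
  also have "(\<Sum>i\<le>a. divpow x (int i) * divpow y (c - int i)
         * divpow z (int a - int i) * divpow w (int b - c + int i)) = Spol (int a) (int b) c x y z w"
    unfolding Spol_def
    by (rule sum.reindex_bij_witness[where i = nat and j = int]) auto
  finally show "((\<lambda>\<theta>. (cis \<theta> * x + z) ^ a * (cis \<theta> * y + w) ^ b * cis \<theta> powi (- c)) has_integral
     of_real (2 * pi) * (fact a * fact b * Spol (int a) (int b) c x y z w)) {0..2 * pi}" .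
qed

text \<open>The dictionary follows from a = l - m, b = l + m, c = l - n with doubled indices: j = 2l
  = a + b, p = 2m = b - a, q = 2n = a + b - 2c.\<close>

lemma tN_eq_eb:
  assumes "0 \<le> a" "0 \<le> b"
  shows "tN (nat (a + b)) (b - a) (a + b - 2 * c) k = (\<lambda>Z. (fact (nat a) * fact (nat b)) * eb a b c k Z)"
proof
  fix Z
  have "tlnm (nat (a + b)) (b - a) (a + b - 2 * c) Z =
      fact (nat a) * fact (nat b) * Spol a b c (Z$1$1) (Z$1$2) (Z$2$1) (Z$2$2)"
  proof -
    have "(int (nat (a + b)) - (b - a)) div 2 = a" "(int (nat (a + b)) + (b - a)) div 2 = b"
      "((a + b - 2 * c) - int (nat (a + b))) div 2 = - c"
      using assms by auto
    then show ?thesis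
      using contour_integral_Spol[of "Z$1$1" "Z$2$1" "nat a" "Z$1$2" "Z$2$2" "nat b" c] assms
      by (simp add: tlnm_def)
  qed
  then show "tN (nat (a + b)) (b - a) (a + b - 2 * c) k Z =
      fact (nat a) * fact (nat b) * eb a b c k Z"
    by (simp add: tN_def eb_def onGL_def)
qed

lemma valid_idxE:
  assumes "valid_idx j p q"
  obtains a b c where "0 \<le> a" "0 \<le> b" "0 \<le> c" "c \<le> a + b"
    "j = nat (a + b)" "p = b - a" "q = a + b - 2 * c"
proof -
  obtain a c where a: "int j - p = 2 * a" and c: "int j - q = 2 * c"
    using assms unfolding valid_idx_def by (elim conjE evenE)
  have "- int j \<le> p" "p \<le> int j" "- int j \<le> q" "q \<le> int j"
    using assms by (auto simp: valid_idx_def abs_le_iff)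
  with a c show thesis
    by (intro that[of a "int j - a" c]) simp_all
qed

lemma valid_idxI:
  assumes "0 \<le> a" "0 \<le> b" "0 \<le> c" "c \<le> a + b"
  shows "valid_idx (nat (a + b)) (b - a) (a + b - 2 * c)"
  using assms unfolding valid_idx_def by auto

lemma cspan_tN:
  "cspan {tN j p q k | j p q k. valid_idx j p q \<and> P (int j) k} = cspan (basis ` region P)" (is "cspan ?T = _")
proof
  show "cspan ?T \<subseteq> cspan (basis ` region P)"
  proof (rule cspan_subset[OF csubspace_cspan], rule subsetI)
    fix f assume "f \<in> ?T"
    then obtain j p q k where f: "f = tN j p q k" and v: "valid_idx j p q" and P: "P (int j) k" by blast
    obtain a b c where abc: "0 \<le> a" "0 \<le> b" "0 \<le> c" "c \<le> a + b"
      and j: "j = nat (a + b)" "p = b - a" "q = a + b - 2 * c" using v by (rule valid_idxE)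
    have "(a, b, c, k) \<in> region P" using abc P j(1) by (simp add: region_def valid_indices_def)
    then have "basis (a, b, c, k) \<in> cspan (basis ` region P)"
      by (intro subsetD[OF cspan_superset] imageI)
    from csubspace_scale[OF csubspace_cspan this] show "f \<in> cspan (basis ` region P)"
      unfolding f j tN_eq_eb[OF abc(1,2)] basis_simp .
  qed
next
  show "cspan (basis ` region P) \<subseteq> cspan ?T"
  proof (rule cspan_subset[OF csubspace_cspan], rule image_subsetI)
    fix i assume i: "i \<in> region P"
    obtain a b c k where I: "i = (a, b, c, k)" by (cases i)
    have abc: "0 \<le> a" "0 \<le> b" "0 \<le> c" "c \<le> a + b" and P: "P (a + b) k"
      using i by (auto simp: I region_def valid_indices_def)
    have "tN (nat (a + b)) (b - a) (a + b - 2 * c) k \<in> ?T"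
      using valid_idxI[OF abc] P abc(1,2)
      by (intro CollectI exI[of _ "nat (a + b)"] exI[of _ "b - a"] exI[of _ "a + b - 2 * c"] exI[of _ k]) simp
    then have "(\<lambda>Z. (fact (nat a) * fact (nat b)) * eb a b c k Z) \<in> cspan ?T"
      unfolding tN_eq_eb[OF abc(1,2)] by (rule subsetD[OF cspan_superset])
    then show "basis i \<in> cspan ?T"
      unfolding I basis_simp by (rule csubspace_scaleD[OF csubspace_cspan]) simp
  qed
qed

lemma Zh_plus_eq: "Zh_plus = cspan (basis ` region P_plus)"
  unfolding Zh_plus_def cspan_tN[symmetric] P_plus_def by simp

lemma Zh_minus_eq: "Zh_minus = cspan (basis ` region P_minus)"
  unfolding Zh_minus_def cspan_tN[symmetric] P_minus_def by simp

lemma Zh_zero_eq: "Zh_zero = cspan (basis ` region P_zero)"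
  unfolding Zh_zero_def cspan_tN[symmetric] P_zero_def by simp

section \<open>The decomposition of Zh\<close>

lemma mult_cspan:
  assumes V: "csubspace V" and gen: "\<And>g. g \<in> S \<Longrightarrow> (\<lambda>Z. h Z * g Z) \<in> V" and f: "f \<in> cspan S"
  shows "(\<lambda>Z. h Z * f Z) \<in> V"
proof -
  obtain T c where T: "finite T" "T \<subseteq> S" and fs: "f = (\<lambda>x. \<Sum>g\<in>T. c g * g x)"
    using f by (rule cspanE)
  have "(\<lambda>Z. h Z * f Z) = (\<lambda>Z. \<Sum>g\<in>T. c g * (h Z * g Z))"
    unfolding fs by (simp add: sum_distrib_left mult_ac)
  then show ?thesis
    using csubspace_sum[OF V T(1), of "\<lambda>g Z. h Z * g Z" c] gen T(2) by auto
qed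

lemma mult_power_closed:
  fixes f :: "'a \<Rightarrow> complex"
  assumes "\<And>f. f \<in> V \<Longrightarrow> (\<lambda>Z. h Z * f Z) \<in> V" "f \<in> V"
  shows "(\<lambda>Z. h Z ^ n * f Z) \<in> V"
proof (induction n)
  case 0
  then show ?case using assms(2) by simp
next
  case (Suc n)
  from assms(1)[OF this] show ?case by (simp add: mult.assoc)
qed

definition Zh_gen :: "nat \<Rightarrow> nat \<Rightarrow> nat \<Rightarrow> nat \<Rightarrow> nat \<Rightarrow> complex^2^2 \<Rightarrow> complex" where
  "Zh_gen a b c d k =
     onGL (\<lambda>Z. (Z$1$1)^a * (Z$1$2)^b * (Z$2$1)^c * (Z$2$2)^d * (inverse (det Z))^k)"

lemma Zh_eq_gen: "Zh = cspan {Zh_gen a b c d k | a b c d k. True}"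
  unfolding Zh_def Zh_gen_def ..

lemma Zh_gen_in: "Zh_gen a b c d k \<in> Zh"
  unfolding Zh_eq_gen by (rule subsetD[OF cspan_superset]) blast

lemma csubspace_Zh: "csubspace Zh"
  unfolding Zh_def by (rule csubspace_cspan)

lemma mult_entry_Zh:
  assumes "f \<in> Zh"
  shows "(\<lambda>Z. Z$i$j * f Z) \<in> Zh"
proof (rule mult_cspan[OF csubspace_Zh _ assms[unfolded Zh_eq_gen]])
  fix g assume "g \<in> {Zh_gen a b c d k | a b c d k. True}"
  then obtain a b c d k where g: "g = Zh_gen a b c d k" by blast
  have "(\<lambda>Z. Z$1$1 * g Z) = Zh_gen (Suc a) b c d k" "(\<lambda>Z. Z$1$2 * g Z) = Zh_gen a (Suc b) c d k"
    "(\<lambda>Z. Z$2$1 * g Z) = Zh_gen a b (Suc c) d k" "(\<lambda>Z. Z$2$2 * g Z) = Zh_gen a b c (Suc d) k"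
    unfolding g by (auto simp: Zh_gen_def onGL_def fun_eq_iff)
  then show "(\<lambda>Z. Z$i$j * g Z) \<in> Zh"
    using exhaust_2[of i] exhaust_2[of j] Zh_gen_in by fastforce
qed

lemma onGL_det_powi_in_Zh: "onGL (\<lambda>Z. det Z powi k) \<in> Zh"
proof (cases "0 \<le> k")
  case True
  have "(\<lambda>Z. det Z * f Z) \<in> Zh" if "f \<in> Zh" for f
    using csubspace_diff[OF csubspace_Zh mult_entry_Zh[OF mult_entry_Zh[OF that, of 2 2], of 1 1]
        mult_entry_Zh[OF mult_entry_Zh[OF that, of 2 1], of 1 2]]
    by (simp add: det_2 algebra_simps)
  then have "(\<lambda>Z. det Z ^ nat k * Zh_gen 0 0 0 0 0 Z) \<in> Zh"
    using Zh_gen_in by (rule mult_power_closed)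
  moreover have "(\<lambda>Z. det Z ^ nat k * Zh_gen 0 0 0 0 0 Z) = onGL (\<lambda>Z. det Z powi k)"
    using True by (auto simp: Zh_gen_def onGL_def fun_eq_iff power_int_def)
  ultimately show ?thesis by simp
next
  case False
  then have "onGL (\<lambda>Z. det Z powi k) = Zh_gen 0 0 0 0 (nat (- k))"
    by (auto simp: Zh_gen_def onGL_def fun_eq_iff power_int_def)
  then show ?thesis using Zh_gen_in by simp
qed

lemma mult_divpow_Zh:
  assumes "f \<in> Zh"
  shows "(\<lambda>Z. divpow (Z$i$j) n * f Z) \<in> Zh"
proof (cases "n < 0")
  case True
  then show ?thesis using csubspace_zero[OF csubspace_Zh] by simp
next
  case False
  have "(\<lambda>Z. inverse (fact (nat n)) * ((Z$i$j) ^ nat n * f Z)) \<in> Zh"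
    by (intro csubspace_scale[OF csubspace_Zh] mult_power_closed mult_entry_Zh assms)
  then show ?thesis using False by (simp add: divpow_def divide_inverse mult_ac)
qed

lemma eb_in_Zh: "eb a b c k \<in> Zh"
proof -
  let ?N = "onGL (\<lambda>Z. det Z powi k)"
  have "eb a b c k = (\<lambda>Z. \<Sum>i\<in>{0..a}. 1 * (divpow (Z$1$1) i * (divpow (Z$1$2) (c - i) *
      (divpow (Z$2$1) (a - i) * (divpow (Z$2$2) (b - c + i) * ?N Z)))))"
    by (auto simp: eb_def onGL_def Spol_def fun_eq_iff sum_distrib_right mult.assoc)
  also have "\<dots> \<in> Zh"
    by (rule csubspace_sum[OF csubspace_Zh])
      (auto intro!: mult_divpow_Zh onGL_det_powi_in_Zh)
  finally show ?thesis .
qed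

text \<open>Closure under the four entries replaces an explicit expansion of monomials: the product
  formulas keep every product within the span, and the factor a + b + 1 is invertible.\<close>

lemma mult_entry_basis_span:
  assumes "f \<in> cspan (basis ` valid_indices)"
  shows "(\<lambda>Z. Z$r$s * f Z) \<in> cspan (basis ` valid_indices)"
proof (rule mult_cspan[OF csubspace_cspan _ assms])
  define V where "V = cspan (basis ` valid_indices)"
  have V: "csubspace V" unfolding V_def by (rule csubspace_cspan)
  have eb: "eb a b c k \<in> V" for a b c k
  proof (cases "(a, b, c, k) \<in> valid_indices")
    case True
    then have "basis (a, b, c, k) \<in> V" unfolding V_def by (intro subsetD[OF cspan_superset] imageI)
    then show ?thesis by simp
  next
    case False
    then show ?thesis using eb_zero_or_valid[of a b c k] csubspace_zero[OF V] by metis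
  qed
  fix g assume "g \<in> basis ` valid_indices"
  then obtain a b c k where abc: "(a, b, c, k) \<in> valid_indices" and g: "g = eb a b c k"
    by (auto simp: basis_def)
  have nz: "complex_of_int (a + b + 1) \<noteq> 0"
    unfolding of_int_eq_0_iff using abc by (simp add: valid_indices_def)
  have "(\<lambda>Z. of_int (a + b + 1) * (Z$r$s * g Z)) \<in> V"
    using exhaust_2[of r] exhaust_2[of s] unfolding g
    by (elim disjE; hypsubst; unfold mult_eb;
      intro csubspace_add[OF V] csubspace_diff[OF V] csubspace_scale[OF V] eb)
  then show "(\<lambda>Z. Z$r$s * g Z) \<in> cspan (basis ` valid_indices)"
    unfolding V_def[symmetric] by (rule csubspace_scaleD[OF V]) (fact nz)
qed

text \<open>A generator of \<open>Zh\<close> is a monomial in the entries times N^(-k), and N^(-k)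
  is the basis vector with a = b = c = 0. Conversely each S is a polynomial in the entries, and
  \<open>Zh\<close> contains all powers of N.\<close>

lemma Zh_eq_basis_span: "Zh = cspan (basis ` valid_indices)"
proof
  define V where "V = cspan (basis ` valid_indices)"
  show "Zh \<subseteq> cspan (basis ` valid_indices)"
    unfolding Zh_eq_gen
  proof (rule cspan_subset[OF csubspace_cspan], rule subsetI)
    fix g assume "g \<in> {Zh_gen a b c d k | a b c d k. True}"
    then obtain a b c d k where g: "g = Zh_gen a b c d k" by blast
    have "basis (0, 0, 0, - int k) \<in> V"
      unfolding V_def by (intro subsetD[OF cspan_superset] imageI) (simp add: valid_indices_def)
    then have 0: "eb 0 0 0 (- int k) \<in> V" by simp
    have m: "(\<lambda>Z. (Z$r$s) ^ n * f Z) \<in> V" if "f \<in> V" for r s n f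
      by (rule mult_power_closed[OF _ that]) (unfold V_def, rule mult_entry_basis_span)
    have "(\<lambda>Z. (Z$1$1)^a * ((Z$1$2)^b * ((Z$2$1)^c * ((Z$2$2)^d * eb 0 0 0 (- int k) Z)))) \<in> V"
      by (rule m, rule m, rule m, rule m, rule 0)
    also have "(\<lambda>Z. (Z$1$1)^a * ((Z$1$2)^b * ((Z$2$1)^c * ((Z$2$2)^d * eb 0 0 0 (- int k) Z)))) = g"
      by (auto simp: g Zh_gen_def eb_def onGL_def Spol_def fun_eq_iff power_int_minus power_inverse mult.assoc)
    finally show "g \<in> cspan (basis ` valid_indices)" unfolding V_def .
  qed
  show "cspan (basis ` valid_indices) \<subseteq> Zh"
    by (rule cspan_subset[OF csubspace_Zh]) (auto simp: basis_def eb_in_Zh)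
qed

lemma basis_independent:
  assumes "finite F" "F \<subseteq> valid_indices" "(\<lambda>Z. \<Sum>i\<in>F. c i * basis i Z) = (\<lambda>Z. 0)" "i \<in> F"
  shows "c i = 0"
proof (rule ccontr)
  assume "c i \<noteq> 0"
  have "basis i \<in> {\<lambda>Z. 0}"
    by (rule basis_projection[where F = F and c = c,
        OF csubspace_zero_space rho1_invariant_zero_space assms(1,2) _ assms(4) \<open>c i \<noteq> 0\<close>])
      (simp only: assms(3) singleton_iff)
  moreover have "basis i \<noteq> (\<lambda>Z. 0)"
    using assms(2,4) eb_nonzero by (cases i) auto
  ultimately show False by simp
qed

lemma region_partition:
  "valid_indices = region P_minus \<union> region P_zero \<union> region P_plus"
  "region P_minus \<inter> region P_zero = {}" "region P_minus \<inter> region P_plus = {}"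
  "region P_zero \<inter> region P_plus = {}"
  by (auto simp: region_def valid_indices_def P_minus_def P_zero_def P_plus_def)

lemma Zh_decomposition:
  "Zh = {(\<lambda>Z. f Z + g Z + h Z) | f g h. f \<in> Zh_minus \<and> g \<in> Zh_zero \<and> h \<in> Zh_plus}" (is "_ = ?R")
proof
  let ?U = "\<lambda>P. cspan (basis ` region P)"
  have sub: "?U P \<subseteq> Zh" for P
    unfolding Zh_eq_basis_span
    by (rule cspan_subset[OF csubspace_cspan]) (use region_subset cspan_superset in blast)
  show "?R \<subseteq> Zh"
    unfolding Zh_plus_eq Zh_minus_eq Zh_zero_eq
    using sub csubspace_add[OF csubspace_Zh] by blast
  show "Zh \<subseteq> ?R"
  proof
    fix f assume "f \<in> Zh"
    then obtain F c where F: "finite F" "F \<subseteq> valid_indices" and f: "f = (\<lambda>x. \<Sum>i\<in>F. c i * basis i x)"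
      unfolding Zh_eq_basis_span by (rule cspan_imageE)
    define G where "G P = (\<lambda>x. \<Sum>i\<in>F \<inter> region P. c i * basis i x)" for P
    have G: "G P \<in> ?U P" for P
      unfolding G_def by (rule csubspace_sum[OF csubspace_cspan])
        (use F in \<open>auto intro!: subsetD[OF cspan_superset]\<close>)
    have F': "F = (F \<inter> region P_minus \<union> F \<inter> region P_zero) \<union> F \<inter> region P_plus"
      using F(2) region_partition(1) by blast
    have "f = (\<lambda>x. G P_minus x + G P_zero x + G P_plus x)"
    proof
      fix x
      have "f x = (\<Sum>i\<in>(F \<inter> region P_minus \<union> F \<inter> region P_zero) \<union> F \<inter> region P_plus. c i * basis i x)"
        unfolding f F'[symmetric] ..
      also have "\<dots> = (\<Sum>i\<in>F \<inter> region P_minus \<union> F \<inter> region P_zero. c i * basis i x) + G P_plus x"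
        unfolding G_def by (rule sum.union_disjoint) (use F(1) region_partition in auto)
      also have "(\<Sum>i\<in>F \<inter> region P_minus \<union> F \<inter> region P_zero. c i * basis i x) = G P_minus x + G P_zero x"
        unfolding G_def by (rule sum.union_disjoint) (use F(1) region_partition in auto)
      finally show "f x = G P_minus x + G P_zero x + G P_plus x" .
    qed
    then show "f \<in> ?R"
      unfolding Zh_plus_eq Zh_minus_eq Zh_zero_eq using G by blast
  qed
qed

lemma Zh_sum_direct:
  assumes "f \<in> Zh_minus" "g \<in> Zh_zero" "h \<in> Zh_plus" and sum: "(\<lambda>Z. f Z + g Z + h Z) = (\<lambda>Z. 0)"
  shows "f = (\<lambda>Z. 0) \<and> g = (\<lambda>Z. 0) \<and> h = (\<lambda>Z. 0)"
proof -
  obtain F1 c1 where F1: "finite F1" "F1 \<subseteq> region P_minus" and f: "f = (\<lambda>x. \<Sum>i\<in>F1. c1 i * basis i x)"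
    using assms(1) unfolding Zh_minus_eq by (rule cspan_imageE)
  obtain F2 c2 where F2: "finite F2" "F2 \<subseteq> region P_zero" and g: "g = (\<lambda>x. \<Sum>i\<in>F2. c2 i * basis i x)"
    using assms(2) unfolding Zh_zero_eq by (rule cspan_imageE)
  obtain F3 c3 where F3: "finite F3" "F3 \<subseteq> region P_plus" and h: "h = (\<lambda>x. \<Sum>i\<in>F3. c3 i * basis i x)"
    using assms(3) unfolding Zh_plus_eq by (rule cspan_imageE)
  \<comment> \<open>The regions are disjoint, so the three families merge into one without conflict
    and a single application of \<open>basis_independent\<close> suffices.\<close>
  define c where "c i = (if i \<in> F1 then c1 i else if i \<in> F2 then c2 i else c3 i)" for i
  have disj: "F1 \<inter> F2 = {}" "(F1 \<union> F2) \<inter> F3 = {}"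
    using F1 F2 F3 region_partition by blast+
  have c: "i \<in> F1 \<Longrightarrow> c i = c1 i" "i \<in> F2 \<Longrightarrow> c i = c2 i" "i \<in> F3 \<Longrightarrow> c i = c3 i" for i
    using disj by (auto simp: c_def)
  have "(\<Sum>i\<in>F1 \<union> F2 \<union> F3. c i * basis i Z) = f Z + g Z + h Z" for Z
  proof -
    have "(\<Sum>i\<in>F1 \<union> F2 \<union> F3. c i * basis i Z) =
        (\<Sum>i\<in>F1. c i * basis i Z) + (\<Sum>i\<in>F2. c i * basis i Z) + (\<Sum>i\<in>F3. c i * basis i Z)"
      using F1(1) F2(1) F3(1) disj by (simp add: sum.union_disjoint)
    then show ?thesis unfolding f g h by (simp add: c)
  qed
  then have "(\<lambda>Z. \<Sum>i\<in>F1 \<union> F2 \<union> F3. c i * basis i Z) = (\<lambda>Z. 0)"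
    using sum by simp
  moreover have "finite (F1 \<union> F2 \<union> F3)" "F1 \<union> F2 \<union> F3 \<subseteq> valid_indices"
    using F1 F2 F3 region_partition(1) by auto
  ultimately have "c i = 0" if "i \<in> F1 \<union> F2 \<union> F3" for i
    using that by (intro basis_independent[where F = "F1 \<union> F2 \<union> F3" and c = c])
  then have "\<And>i. i \<in> F1 \<Longrightarrow> c1 i = 0" "\<And>i. i \<in> F2 \<Longrightarrow> c2 i = 0" "\<And>i. i \<in> F3 \<Longrightarrow> c3 i = 0"
    using c by fastforce+
  then show ?thesis unfolding f g h by simp
qed

theorem mainTheorem2:
  shows "Zh = {(\<lambda>Z. f Z + g Z + h Z) | f g h. f \<in> Zh_minus \<and> g \<in> Zh_zero \<and> h \<in> Zh_plus}
    \<and> (\<forall>f\<in>Zh_minus. \<forall>g\<in>Zh_zero. \<forall>h\<in>Zh_plus.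
          (\<lambda>Z. f Z + g Z + h Z) = (\<lambda>Z. 0) \<longrightarrow> f = (\<lambda>Z. 0) \<and> g = (\<lambda>Z. 0) \<and> h = (\<lambda>Z. 0))
    \<and> rho1_invariant Zh_minus \<and> rho1_invariant Zh_zero \<and> rho1_invariant Zh_plus
    \<and> rho1_irreducible Zh_minus \<and> rho1_irreducible Zh_zero \<and> rho1_irreducible Zh_plus"
proof (intro conjI ballI impI)
  show "Zh = {(\<lambda>Z. f Z + g Z + h Z) | f g h. f \<in> Zh_minus \<and> g \<in> Zh_zero \<and> h \<in> Zh_plus}"
    by (rule Zh_decomposition)
next
  fix f g h
  assume "f \<in> Zh_minus" "g \<in> Zh_zero" "h \<in> Zh_plus" "(\<lambda>Z. f Z + g Z + h Z) = (\<lambda>Z. 0)"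
  from Zh_sum_direct[OF this] show "f = (\<lambda>Z. 0)" "g = (\<lambda>Z. 0)" "h = (\<lambda>Z. 0)" by blast+
next
  show "rho1_invariant Zh_minus" "rho1_invariant Zh_zero" "rho1_invariant Zh_plus"
    unfolding Zh_plus_eq Zh_minus_eq Zh_zero_eq
    by (intro rho1_invariant_region step_closed_regions)+
next
  show "rho1_irreducible Zh_minus" "rho1_irreducible Zh_zero" "rho1_irreducible Zh_plus"
    unfolding Zh_plus_eq Zh_minus_eq Zh_zero_eq
    by (intro rho1_irreducible_region linked_minus linked_zero linked_plus)+
qed

end
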